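(* Let $K$ be a field. Any polymatroidal ideal $I\subset S=K[x_1,\ldots,x_n]$ is of strong intersection type.
   Context: For $\mathbf u=(u_1,\dots,u_n)\in\mathbb Z_{\ge0}^n$ write $|\mathbf u|=\sum_i u_i$ and $\mathbf x^{\mathbf u}=x_1^{u_1}\cdots x_n^{u_n}$. A discrete polymatroid on the ground set $[n]=\{1,\dots,n\}$ is a nonempty finite set $\mathcal P\subset\mathbb Z_{\geq0}^n$ such that (1) if $\mathbf u\in\mathcal P$ and $\mathbf v\in\mathbb Z_{\ge 0}^n$ satisfies $\mathbf v\leq\mathbf u$ componentwise, then $\mathbf v\in\mathcal P$; (2) if $\mathbf u,\mathbf v\in\mathcal P$ with $|\mathbf u|<|\mathbf v|$, then there is $\mathbf w\in\mathcal P$ with $\mathbf u<\mathbf w\leq\mathbf u\vee\mathbf v$, where $\mathbf u\vee\mathbf v$ is the componentwise maximum. The set $B(\mathcal P)$ of bases consists of the $\mathbf u\in\mathcal P$ with $|\mathbf u|$ maximal; this maximal value $d$ is the rank of $\mathcal P$. The polymatroidal ideal associated with $\mathcal P$ is the monomial ideal generated by all $\mathbf x^{\mathbf u}$ with $\mathbf u\in B(\mathcal P)$. A monomial prime ideal is a prime ideal generated by a subset of the variables. A monomial ideal $I$ is of intersection type if it is an intersection of powers (with positive integer exponents; the empty intersection is $S$) of monomial prime ideals. In that case it has a unique irredundant such presentation, of the form $I=\bigcap_{\mathfrak p\in\operatorname{Ass}(S/I)}\mathfrak p^{d_{\mathfrak p}}$. The ideal $I$ is of strong intersection type if it is of intersection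 type and $d_{\mathfrak p}=\operatorname{reg}(I(\mathfrak p))$ for all $\mathfrak p\in\operatorname{Ass}(S/I)$. Here $\operatorname{reg}$ is Castelnuovo–Mumford regularity and $I(\mathfrak p)$ is the monomial localization: the image of $I$ under the $K$-algebra homomorphism $S\to S(\mathfrak p)$, where $S(\mathfrak p)$ is the polynomial ring over $K$ in the variables belonging to $\mathfrak p$, with $x_i\mapsto x_i$ if $x_i\in\mathfrak p$ and $x_i\mapsto1$ otherwise. *)

theory Defs
  imports
    "HOL-Algebra.Ideal_Product"
    "HOL-Library.Poly_Mapping"
    "Jordan_Normal_Form.Matrix"
begin

text \<open>
  Exponent vectors are finitely supported functions on the variable indices, and polynomials
  over \<open>'k\<close> in countably many variables are finitely supported functions on exponent vectors.
  The library order on \<open>nat \<Rightarrow>\<^sub>0 nat\<close> is lexicographic; the componentwise order is therefore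
  spelled out below.
\<close>

type_synonym expo = "nat \<Rightarrow>\<^sub>0 nat"
type_synonym 'k mpol = "(nat \<Rightarrow>\<^sub>0 nat) \<Rightarrow>\<^sub>0 'k"

definition tdeg :: "expo \<Rightarrow> nat" where
  "tdeg u = (\<Sum>i\<in>Poly_Mapping.keys u. Poly_Mapping.lookup u i)"

definition cle :: "expo \<Rightarrow> expo \<Rightarrow> bool" where
  "cle u v \<longleftrightarrow> (\<forall>i. Poly_Mapping.lookup u i \<le> Poly_Mapping.lookup v i)"


section \<open>Discrete polymatroids\<close>

text \<open>The ground set is \<open>V\<close>; the last condition \<open>lookup w i \<le> max \<dots>\<close> says that \<open>w\<close> lies below the
  componentwise maximum of \<open>u\<close> and \<open>v\<close>.\<close>

definition discrete_polymatroid :: "nat set \<Rightarrow> expo set \<Rightarrow> bool" where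
  "discrete_polymatroid V P \<longleftrightarrow>
     finite P \<and> P \<noteq> {} \<and> (\<forall>u\<in>P. Poly_Mapping.keys u \<subseteq> V) \<and>
     (\<forall>u\<in>P. \<forall>v. cle v u \<longrightarrow> v \<in> P) \<and>
     (\<forall>u\<in>P. \<forall>v\<in>P. tdeg u < tdeg v \<longrightarrow>
        (\<exists>w\<in>P. cle u w \<and> u \<noteq> w \<and>
           (\<forall>i. Poly_Mapping.lookup w i
                \<le> max (Poly_Mapping.lookup u i) (Poly_Mapping.lookup v i))))"

definition bases :: "expo set \<Rightarrow> expo set" where
  "bases P = {u\<in>P. \<forall>v\<in>P. tdeg v \<le> tdeg u}"


section \<open>Polynomial rings and monomial ideals\<close>

definition mpoly_ring :: "nat set \<Rightarrow> 'k::field mpol ring" where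
  "mpoly_ring V =
     \<lparr>carrier = {f. \<forall>m\<in>Poly_Mapping.keys f. Poly_Mapping.keys m \<subseteq> V},
      monoid.mult = (*), one = 1, zero = 0, add = (+)\<rparr>"

definition xpow :: "expo \<Rightarrow> 'k::field mpol" where
  "xpow u = Poly_Mapping.single u 1"

definition var :: "nat \<Rightarrow> 'k::field mpol" where
  "var i = xpow (Poly_Mapping.single i 1)"

definition var_ideal :: "nat set \<Rightarrow> nat set \<Rightarrow> 'k::field mpol set" where
  "var_ideal V A = Idl\<^bsub>mpoly_ring V\<^esub> (var ` A)"

definition monomial_ideal :: "nat set \<Rightarrow> 'k::field mpol set \<Rightarrow> bool" where
  "monomial_ideal V I \<longleftrightarrow>
     (\<exists>M. (\<forall>u\<in>M. Poly_Mapping.keys u \<subseteq> V) \<and> I = Idl\<^bsub>mpoly_ring V\<^esub> (xpow ` M))"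

definition polymatroidal_ideal :: "nat set \<Rightarrow> 'k::field mpol set \<Rightarrow> bool" where
  "polymatroidal_ideal V I \<longleftrightarrow>
     (\<exists>P. discrete_polymatroid V P \<and> I = Idl\<^bsub>mpoly_ring V\<^esub> (xpow ` bases P))"

definition monomial_prime :: "nat set \<Rightarrow> 'k::field mpol set \<Rightarrow> bool" where
  "monomial_prime V p \<longleftrightarrow> primeideal p (mpoly_ring V) \<and> (\<exists>A\<subseteq>V. p = var_ideal V A)"

text \<open>The primes of the form \<open>Ann(f + I)\<close> with \<open>f + I \<in> R/I\<close>.\<close>

definition associated_primes :: "('a, 'b) ring_scheme \<Rightarrow> 'a set \<Rightarrow> 'a set set" where
  "associated_primes R I =
     {p. primeideal p R \<and> (\<exists>f\<in>carrier R. p = {g\<in>carrier R. g \<otimes>\<^bsub>R\<^esub> f \<in> I})}"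


section \<open>Monomial localization\<close>

text \<open>The \<open>K\<close>-algebra homomorphism with \<open>x\<^sub>i \<mapsto> x\<^sub>i\<close> for \<open>i \<in> A\<close> and \<open>x\<^sub>i \<mapsto> 1\<close> otherwise.\<close>

definition loc_hom :: "nat set \<Rightarrow> 'k::field mpol \<Rightarrow> 'k mpol" where
  "loc_hom A f =
     (\<Sum>m\<in>Poly_Mapping.keys f. Poly_Mapping.single 0 (Poly_Mapping.lookup f m) *
        (\<Prod>i\<in>Poly_Mapping.keys m. (if i \<in> A then var i else 1) ^ Poly_Mapping.lookup m i))"

definition prime_vars :: "nat set \<Rightarrow> 'k::field mpol set \<Rightarrow> nat set" where
  "prime_vars V p = {i\<in>V. var i \<in> p}"

definition monomial_localization ::
  "nat set \<Rightarrow> 'k::field mpol set \<Rightarrow> 'k mpol set \<Rightarrow> 'k mpol set" where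
  "monomial_localization V I p = loc_hom (prime_vars V p) ` I"


section \<open>Castelnuovo--Mumford regularity\<close>

definition free_vecs :: "nat set \<Rightarrow> nat \<Rightarrow> 'k::field mpol vec set" where
  "free_vecs V r = {v\<in>carrier_vec r. \<forall>k<r. v $ k \<in> carrier (mpoly_ring V)}"

text \<open>
  A minimal graded free resolution \<open>\<dots> \<rightarrow> F\<^sub>1 \<rightarrow> F\<^sub>0 \<rightarrow> J \<rightarrow> 0\<close> of an ideal \<open>J\<close> of \<open>S = mpoly_ring V\<close>.
  Here \<open>F\<^sub>i\<close> is the direct sum of the \<open>S(- a i j)\<close> for \<open>j < dim_col (D i)\<close>, the one-row matrix \<open>D 0\<close>
  describes the augmentation \<open>F\<^sub>0 \<rightarrow> J \<subseteq> S\<close>, and \<open>D (i + 1)\<close> describes the differential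
  \<open>F\<^sub>i\<^sub>+\<^sub>1 \<rightarrow> F\<^sub>i\<close>. All maps have degree 0, so the entry of \<open>D (i + 1)\<close> in position \<open>(k, j)\<close> is
  homogeneous of degree \<open>a (i + 1) j - a i k\<close> (in particular it is 0 if this number is negative).
  Minimality means that \<open>F\<^sub>i\<^sub>+\<^sub>1\<close> is mapped into \<open>\<mm> F\<^sub>i\<close>, where \<open>\<mm> = var_ideal V V\<close>.
  Natural numbers suffice as shifts since the generators of \<open>J\<close> have nonnegative degrees.
\<close>

definition minimal_graded_free_resolution ::
  "nat set \<Rightarrow> 'k::field mpol set \<Rightarrow> (nat \<Rightarrow> nat \<Rightarrow> nat) \<Rightarrow> (nat \<Rightarrow> 'k mpol mat) \<Rightarrow> bool" where
  "minimal_graded_free_resolution V J a D \<longleftrightarrow>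
     dim_row (D 0) = 1 \<and>
     (\<forall>i. dim_row (D (Suc i)) = dim_col (D i)) \<and>
     (\<forall>i. elements_mat (D i) \<subseteq> carrier (mpoly_ring V)) \<and>
     (\<forall>j<dim_col (D 0). \<forall>m\<in>Poly_Mapping.keys (D 0 $$ (0, j)). tdeg m = a 0 j) \<and>
     (\<forall>i. \<forall>k<dim_col (D i). \<forall>j<dim_col (D (Suc i)).
        \<forall>m\<in>Poly_Mapping.keys (D (Suc i) $$ (k, j)). tdeg m + a i k = a (Suc i) j) \<and>
     (\<lambda>v. (D 0 *\<^sub>v v) $ 0) ` free_vecs V (dim_col (D 0)) = J \<and>
     (\<forall>i. (\<lambda>v. D (Suc i) *\<^sub>v v) ` free_vecs V (dim_col (D (Suc i)))
          = {v\<in>free_vecs V (dim_col (D i)). D i *\<^sub>v v = 0\<^sub>v (dim_row (D i))}) \<and>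
     (\<forall>i. elements_mat (D (Suc i)) \<subseteq> var_ideal V V)"

text \<open>
  The regularity of a nonzero graded ideal \<open>J\<close>: the maximum of the numbers \<open>a i j - i\<close>, that is the
  least \<open>r\<close> with \<open>a i j \<le> r + i\<close> throughout, for the shifts \<open>a i j\<close> of the minimal graded free
  resolution of \<open>J\<close>. Since that resolution is unique up to isomorphism, every choice of \<open>a\<close> and \<open>D\<close>
  admits the same \<open>r\<close>.
\<close>

definition regularity :: "nat set \<Rightarrow> 'k::field mpol set \<Rightarrow> nat" where
  "regularity V J =
     (LEAST r. \<exists>a D. minimal_graded_free_resolution V J a D \<and>
                     (\<forall>i. \<forall>j<dim_col (D i). a i j \<le> r + i))"


section \<open>Ideals of (strong) intersection type\<close>

text \<open>A pair \<open>(p, k)\<close> stands for the ideal power \<open>p\<^sup>k\<close>.\<close>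

definition powers_inter :: "('a, 'b) ring_scheme \<Rightarrow> ('a set \<times> nat) set \<Rightarrow> 'a set" where
  "powers_inter R F = carrier R \<inter> (\<Inter>(p, k)\<in>F. p [^]\<^bsub>ideals_set R\<^esub> k)"

definition presentation ::
  "nat set \<Rightarrow> 'k::field mpol set \<Rightarrow> ('k mpol set \<times> nat) set \<Rightarrow> bool" where
  "presentation V I F \<longleftrightarrow>
     finite F \<and> (\<forall>(p, k)\<in>F. monomial_prime V p \<and> 0 < k) \<and> I = powers_inter (mpoly_ring V) F"

definition irredundant_presentation ::
  "nat set \<Rightarrow> 'k::field mpol set \<Rightarrow> ('k mpol set \<times> nat) set \<Rightarrow> bool" where
  "irredundant_presentation V I F \<longleftrightarrow>
     presentation V I F \<and> (\<forall>G. G \<subset> F \<longrightarrow> powers_inter (mpoly_ring V) G \<noteq> I)"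

definition intersection_type :: "nat set \<Rightarrow> 'k::field mpol set \<Rightarrow> bool" where
  "intersection_type V I \<longleftrightarrow> monomial_ideal V I \<and> (\<exists>F. presentation V I F)"

text \<open>The exponents \<open>d p\<close> below are those of the irredundant presentation indexed by \<open>Ass(S/I)\<close>,
  which is unique. The regularity of \<open>I(p)\<close> is taken over \<open>S(p)\<close>.\<close>

definition strong_intersection_type :: "nat set \<Rightarrow> 'k::field mpol set \<Rightarrow> bool" where
  "strong_intersection_type V I \<longleftrightarrow>
     intersection_type V I \<and>
     (\<exists>d. irredundant_presentation V I
            ((\<lambda>p. (p, d p)) ` associated_primes (mpoly_ring V) I) \<and>
          (\<forall>p\<in>associated_primes (mpoly_ring V) I.
             d p = regularity (prime_vars V p) (monomial_localization V I p)))"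

end

theory Submission
  imports Defs "HOL-Library.Product_Lexorder"
begin

text \<open>
Let \<open>B\<close> be the set of bases of the polymatroid. For a set \<open>A\<close> of variables write \<open>|m|\<^sub>A\<close> for the degree
of the monomial with exponent \<open>m\<close> in the variables of \<open>A\<close>, let \<open>d\<^sub>A\<close> be the minimum of \<open>|u|\<^sub>A\<close> over
\<open>u \<in> B\<close>, and let \<open>\<pp>\<^sub>A\<close> be the prime generated by \<open>A\<close>. All exponents in the theorem turn out to be
numbers \<open>d\<^sub>A\<close>, and the polymatroid enters through the exchange property of its bases.

Why the ideal \<open>I\<close> is an intersection of powers: a monomial lies in \<open>\<pp>\<^sub>A\<^sup>k\<close> iff its degree in \<open>A\<close> is at least
\<open>k\<close>. So \<open>I\<close> is the intersection of all \<open>\<pp>\<^sub>A\<close> to the power \<open>d\<^sub>A\<close> as soon as every \<open>w\<close> with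
\<open>|w|\<^sub>A \<ge> d\<^sub>A\<close> for all \<open>A\<close> dominates a base. This is \<open>dominates_base_iff\<close>: take a base \<open>u\<close> that exceeds \<open>w\<close>
as little as possible; if it exceeds \<open>w\<close> at all, let \<open>A\<close> be the set of coordinates that can be reached by
exchanges from those where it does. Then \<open>u\<close> is at least \<open>w\<close> on \<open>A\<close>, and as no exchange leads out of \<open>A\<close>,
\<open>u\<close> attains the minimum \<open>d\<^sub>A\<close>; hence \<open>|w|\<^sub>A < d\<^sub>A\<close>.

Why the components are the associated primes: pick a minimal family of sets \<open>A\<close> that still cuts out \<open>I\<close>.
For \<open>A\<close> in the family, minimality provides a monomial that satisfies all conditions but the one for \<open>A\<close>,
which it misses by one (\<open>critical_exponent\<close>); its annihilator modulo \<open>I\<close> is \<open>\<pp>\<^sub>A\<close>. There are no further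
associated primes since the powers of \<open>\<pp>\<^sub>A\<close> are primary (\<open>primary_cancel\<close>).

Why the exponents are regularities: the localization at \<open>\<pp>\<^sub>A\<close> is generated by the restrictions to \<open>A\<close> of
those bases \<open>u\<close> with \<open>|u|\<^sub>A = d\<^sub>A\<close>, and these restrictions again have the exchange property
(\<open>exchange_family_restr\<close>). It remains to see that an ideal generated in degree \<open>d\<close> by an exchange family
has a linear resolution (\<open>regularity_base_ideal\<close>). Ordered lexicographically, its generators have linear
quotients (\<open>linear_quotients_bases\<close>). The point is that linear quotients, formulated for the columns of a matrix,
are inherited by a matrix of syzygies (\<open>linear_quotients_syzygies\<close>): if the quotient at the \<open>k\<close>-th
column is generated by the variables in \<open>A\<^sub>k\<close>, then the syzygies with leading term \<open>x\<^sub>i e\<^sub>k\<close>,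
\<open>i \<in> A\<^sub>k\<close>, generate all syzygies, have linear entries, and the quotient at the one of index \<open>(k, i)\<close> is generated by the
\<open>x\<^sub>j\<close> with \<open>j \<in> A\<^sub>k\<close> and \<open>j < i\<close>. Iterating gives the resolution.
\<close>

section \<open>Exponent vectors and exchange families\<close>

abbreviation lookup where "lookup \<equiv> Poly_Mapping.lookup"
abbreviation keys where "keys \<equiv> Poly_Mapping.keys"

definition adeg :: "nat set \<Rightarrow> expo \<Rightarrow> nat" where
  "adeg A m = (\<Sum>i\<in>A. lookup m i)"

lemma adeg_add: "adeg A (l + m) = adeg A l + adeg A m"
  by (simp add: adeg_def lookup_add sum.distrib)

lemma adeg_single: "finite A \<Longrightarrow> adeg A (Poly_Mapping.single i c) = (if i \<in> A then c else 0)"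
  by (simp add: adeg_def lookup_single when_def)

lemma adeg_zero [simp]: "adeg A 0 = 0"
  by (simp add: adeg_def)

lemma tdeg_eq_adeg:
  assumes "finite A" "keys m \<subseteq> A"
  shows "tdeg m = adeg A m"
  unfolding tdeg_def adeg_def
  by (rule sum.mono_neutral_left) (use assms in \<open>auto simp: in_keys_iff\<close>)

lemma tdeg_add: "tdeg (l + m) = tdeg l + tdeg m"
  using adeg_add[of "keys l \<union> keys m" l m] keys_add[of l m]
  by (simp add: tdeg_eq_adeg[of "keys l \<union> keys m"])

lemma tdeg_single: "tdeg (Poly_Mapping.single i c) = c"
  by (simp add: tdeg_def)

lemma adeg_mono: "cle l m \<Longrightarrow> adeg A l \<le> adeg A m"
  by (simp add: adeg_def cle_def sum_mono)

lemma cle_add_diff: "cle u m \<Longrightarrow> (m - u) + u = m"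
  by (rule poly_mapping_eqI) (simp add: lookup_add lookup_minus cle_def)

lemma cle_add: "cle u (l + u)"
  by (simp add: cle_def lookup_add)

lemma cle_trans: "cle u v \<Longrightarrow> cle v w \<Longrightarrow> cle u w"
  unfolding cle_def by (meson order_trans)

lemma cle_imp_keys: "cle u v \<Longrightarrow> keys u \<subseteq> keys v"
  unfolding cle_def by (metis in_keys_iff le_zero_eq subsetI)

text \<open>
The subtraction of exponent vectors truncates, so this is an exchange of one unit of \<open>i\<close> for one of
\<open>j\<close> only if \<open>u\<close> is positive at \<open>i\<close>.
\<close>

definition move :: "nat \<Rightarrow> nat \<Rightarrow> expo \<Rightarrow> expo" where
  "move i j u = u - Poly_Mapping.single i 1 + Poly_Mapping.single j 1"

lemma lookup_move:
  "lookup (move i j u) k = lookup u k - (if k = i then 1 else 0) + (if k = j then 1 else 0)"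
  by (auto simp: move_def lookup_add lookup_minus lookup_single when_def)

lemma move_balance:
  assumes "lookup u i > 0"
  shows "move i j u + Poly_Mapping.single i 1 = u + Poly_Mapping.single j 1"
  by (rule poly_mapping_eqI)
     (use assms in \<open>auto simp: move_def lookup_add lookup_minus lookup_single when_def\<close>)

lemma adeg_move:
  assumes "finite A" "lookup u i > 0"
  shows "adeg A (move i j u) + (if i \<in> A then 1 else 0) = adeg A u + (if j \<in> A then 1 else 0)"
  using arg_cong[OF move_balance[OF assms(2), of j], of "adeg A"] assms(1)
  by (simp add: adeg_add adeg_single split: if_splits)

lemma tdeg_move: "lookup u i > 0 \<Longrightarrow> tdeg (move i j u) = tdeg u"
  using arg_cong[OF move_balance[of u i j], of tdeg] by (simp add: tdeg_add tdeg_single)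

text \<open>
The exponent of the largest power of the prime generated by \<open>A\<close> that contains all the monomials with exponents in \<open>B\<close>.
\<close>

definition mindeg :: "expo set \<Rightarrow> nat set \<Rightarrow> nat" where
  "mindeg B A = Min (adeg A ` B)"

text \<open>
The bases of a discrete polymatroid, described by their exchange property. Working with these
families rather than with polymatroids makes it possible to treat a localization without exhibiting the
polymatroid it comes from.
\<close>

locale exchange_family =
  fixes V :: "nat set" and B :: "expo set" and d :: nat
  assumes finite_ground: "finite V"
    and finite_family: "finite B"
    and nonempty: "B \<noteq> {}"
    and in_ground: "u \<in> B \<Longrightarrow> keys u \<subseteq> V"
    and equal_degree: "u \<in> B \<Longrightarrow> tdeg u = d"
    and exchange: "\<lbrakk>u \<in> B; v \<in> B; lookup v i < lookup u i\<rbrakk>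
                    \<Longrightarrow> \<exists>j. lookup u j < lookup v j \<and> move i j u \<in> B"
begin

lemma outside_ground: "u \<in> B \<Longrightarrow> i \<notin> V \<Longrightarrow> lookup u i = 0"
  using in_ground in_keys_iff by (metis subsetD)

lemma mindeg_le: "u \<in> B \<Longrightarrow> mindeg B A \<le> adeg A u"
  unfolding mindeg_def by (simp add: finite_family)

lemma mindeg_attained: "\<exists>u\<in>B. adeg A u = mindeg B A"
  unfolding mindeg_def using Min_in[of "adeg A ` B"] finite_family nonempty by fastforce

text \<open>
Among the minimizers on \<open>A\<close> take one that exceeds \<open>u\<close> least. Wherever it still exceeds \<open>u\<close>, an exchange
towards \<open>u\<close> must stay inside \<open>A\<close>, because the degree in \<open>A\<close> cannot drop, and it reduces the excess.
\<close>

lemma minimizer_below: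
  assumes A: "A \<subseteq> V" and u: "u \<in> B"
  shows "\<exists>v\<in>B. adeg A v = mindeg B A \<and> (\<forall>i\<in>A. lookup v i \<le> lookup u i)"
proof -
  define ex where "ex = (\<lambda>v. \<Sum>i\<in>A. lookup v i - lookup u i)"
  have fin: "finite A" using A finite_ground finite_subset by blast
  obtain v where v: "v \<in> B" "adeg A v = mindeg B A"
    and least: "\<And>v'. v' \<in> B \<Longrightarrow> adeg A v' = mindeg B A \<Longrightarrow> ex v \<le> ex v'"
    using mindeg_attained[of A]
      ex_has_least_nat[of "\<lambda>v. v \<in> B \<and> adeg A v = mindeg B A" _ ex] by blast
  have "lookup v j \<le> lookup u j" if j: "j \<in> A" for j
  proof (rule ccontr)
    assume "\<not> lookup v j \<le> lookup u j"
    then have gt: "lookup u j < lookup v j" by simp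
    then obtain i where i: "lookup v i < lookup u i" "move j i v \<in> B"
      using exchange[OF v(1) u] by blast
    have ij: "i \<noteq> j" using i gt by auto
    have "adeg A (move j i v) + 1 = adeg A v + (if i \<in> A then 1 else 0)"
      using adeg_move[OF fin, of v j i] gt j by simp
    then have iA: "i \<in> A" and min: "adeg A (move j i v) = mindeg B A"
      using mindeg_le[OF i(2), of A] v(2) by (auto split: if_splits)
    have "ex (move j i v) < ex v"
      unfolding ex_def
      by (rule sum_strict_mono_ex1[OF fin])
         (use j gt i ij in \<open>auto simp: lookup_move intro!: bexI[of _ j]\<close>)
    then show False using least[OF i(2) min] by simp
  qed
  then show ?thesis using v by blast
qed

text \<open>
By \<open>minimizer_below\<close> there is a minimizer below \<open>u\<close> on \<open>A\<close>. If it is strictly below at \<open>j \<in> A\<close>, then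
exchanging \<open>j\<close> in \<open>u\<close> brings in a coordinate where the minimizer is larger, hence one outside \<open>A\<close>.
\<close>

lemma exchange_closed_imp_minimizer:
  assumes A: "A \<subseteq> V" and u: "u \<in> B"
    and closed: "\<And>j k. \<lbrakk>j \<in> A; 0 < lookup u j; k \<in> V - A\<rbrakk> \<Longrightarrow> move j k u \<notin> B"
  shows "adeg A u = mindeg B A"
proof -
  obtain v where v: "v \<in> B" "adeg A v = mindeg B A" "\<And>i. i \<in> A \<Longrightarrow> lookup v i \<le> lookup u i"
    using minimizer_below[OF A u] by blast
  have "lookup u j \<le> lookup v j" if j: "j \<in> A" for j
  proof (rule ccontr)
    assume less: "\<not> lookup u j \<le> lookup v j"
    then obtain k where k: "lookup u k < lookup v k" "move j k u \<in> B"
      using exchange[OF u v(1), of j] by auto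
    have "k \<in> V - A" using k v(1) v(3)[of k] outside_ground[of v k] by fastforce
    then show False using closed[OF j] k(2) less by simp
  qed
  then have "adeg A u \<le> adeg A v" unfolding adeg_def by (intro sum_mono)
  then show ?thesis using v(2) mindeg_le[OF u, of A] by simp
qed

text \<open>
The bases \<open>move j i u\<close> and \<open>move i k u\<close> differ by \<open>e\<^sub>j + e\<^sub>k - 2 e\<^sub>i\<close>, so that giving up \<open>j\<close> in the second one
can only bring back \<open>i\<close>.
\<close>

lemma exchange_trans:
  assumes u: "u \<in> B" and "j \<noteq> i" "i \<noteq> k" "j \<noteq> k" "0 < lookup u j" "0 < lookup u i"
    and ji: "move j i u \<in> B" and ik: "move i k u \<in> B"
  shows "move j k u \<in> B"
proof -
  have "lookup (move j i u) j < lookup (move i k u) j"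
    using assms by (simp add: lookup_move)
  then obtain l where l: "lookup (move i k u) l < lookup (move j i u) l"
      "move j l (move i k u) \<in> B"
    using exchange[OF ik ji] by blast
  have "l = i" using l(1) by (auto simp: lookup_move split: if_splits)
  moreover have "move j i (move i k u) = move j k u"
    by (rule poly_mapping_eqI) (use assms in \<open>auto simp: lookup_move\<close>)
  ultimately show ?thesis using l(2) by simp
qed

text \<open>
In the language of polytopes: the exponents dominating a base are cut out by the inequalities with
0/1 coefficients alone. This is what makes the ideal an intersection of powers of monomial primes.
\<close>

theorem dominates_base_iff:
  "(\<exists>u\<in>B. cle u w) \<longleftrightarrow> (\<forall>A\<subseteq>V. mindeg B A \<le> adeg A w)"
proof
  assume "\<exists>u\<in>B. cle u w"
  then show "\<forall>A\<subseteq>V. mindeg B A \<le> adeg A w"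
    using mindeg_le adeg_mono order_trans by blast
next
  assume ge: "\<forall>A\<subseteq>V. mindeg B A \<le> adeg A w"
  define ex where "ex = (\<lambda>u. \<Sum>i\<in>V. lookup u i - lookup w i)"
  obtain u where u: "u \<in> B" and least: "\<And>u'. u' \<in> B \<Longrightarrow> ex u \<le> ex u'"
    using nonempty ex_has_least_nat[of "\<lambda>u. u \<in> B" _ ex] by blast
  define X where "X = {i\<in>V. lookup w i < lookup u i}"
  have X_pos: "0 < lookup u j" if "j \<in> X" for j using that by (auto simp: X_def)
  show "\<exists>u\<in>B. cle u w"
  proof (cases "X = {}")
    case True
    then have "cle u w"
      unfolding cle_def X_def using outside_ground[OF u] by (metis (mono_tags, lifting)
        empty_Collect_eq leI zero_le)
    then show ?thesis using u by blast
  next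
    case False
    \<comment> \<open>One step of exchange suffices to reach everything reachable from X, by transitivity.\<close>
    define A where "A = X \<union> {i\<in>V. \<exists>j\<in>X. move j i u \<in> B}"
    have AV: "A \<subseteq> V" by (auto simp: A_def X_def)
    have finA: "finite A" using AV finite_ground finite_subset by blast
    have w_le: "lookup w i \<le> lookup u i" if "i \<in> A" for i
    proof (rule ccontr)
      assume less: "\<not> lookup w i \<le> lookup u i"
      then have "i \<notin> X" by (auto simp: X_def)
      then obtain j where j: "j \<in> X" "move j i u \<in> B" "i \<noteq> j"
        using \<open>i \<in> A\<close> by (auto simp: A_def)
      \<comment> \<open>The exchange lowers the excess at j and, as u is below w at i, creates none there.\<close>
      have "ex (move j i u) < ex u"
        unfolding ex_def
        by (rule sum_strict_mono_ex1[OF finite_ground])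
           (use j less in \<open>auto simp: lookup_move X_def intro!: bexI[of _ j]\<close>)
      then show False using least[OF j(2)] by simp
    qed
    have "adeg A w < adeg A u"
      unfolding adeg_def
      by (rule sum_strict_mono_ex1[OF finA])
         (use w_le False in \<open>auto simp: A_def X_def\<close>)
    moreover have "adeg A u = mindeg B A"
    proof (rule exchange_closed_imp_minimizer[OF AV u])
      fix j k assume j: "j \<in> A" "0 < lookup u j" and k: "k \<in> V - A"
      show "move j k u \<notin> B"
      proof
        assume jk: "move j k u \<in> B"
        have "j \<notin> X" using jk k by (auto simp: A_def)
        then obtain i where i: "i \<in> X" "move i j u \<in> B" using j by (auto simp: A_def)
        have "move i k u \<in> B"
          by (rule exchange_trans[OF u _ _ _ X_pos[OF i(1)] j(2) i(2) jk])
             (use i \<open>j \<notin> X\<close> j k in \<open>auto simp: A_def\<close>)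
        then show False using i k by (auto simp: A_def)
      qed
    qed
    ultimately show ?thesis using ge AV by (metis leD)
  qed
qed

end

text \<open>
The exponent of the monomial that is left when the variables outside \<open>A\<close> are set to 1.
\<close>

definition restr :: "nat set \<Rightarrow> expo \<Rightarrow> expo" where
  "restr A m = (\<Sum>i\<in>A. Poly_Mapping.single i (lookup m i))"

lemma lookup_restr: "finite A \<Longrightarrow> lookup (restr A m) i = (if i \<in> A then lookup m i else 0)"
  by (auto simp: restr_def lookup_sum lookup_single when_def)

lemma keys_restr: "finite A \<Longrightarrow> keys (restr A m) \<subseteq> A"
  by (auto simp: in_keys_iff lookup_restr split: if_splits)

lemma tdeg_restr: "finite A \<Longrightarrow> tdeg (restr A m) = adeg A m"
  by (simp add: tdeg_eq_adeg[OF _ keys_restr] adeg_def lookup_restr)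

text \<open>
An exchange of a coordinate in \<open>A\<close> for one outside would lower the degree in \<open>A\<close> below its minimum, so
exchanges between minimizers happen within \<open>A\<close>.
\<close>

lemma (in exchange_family) exchange_family_restr:
  assumes A: "A \<subseteq> V"
  shows "exchange_family A (restr A ` {u\<in>B. adeg A u = mindeg B A}) (mindeg B A)"
proof -
  have fin: "finite A" using A finite_ground finite_subset by blast
  show ?thesis
  proof
    show "restr A ` {u\<in>B. adeg A u = mindeg B A} \<noteq> {}" using mindeg_attained[of A] by blast
    fix u' v' i
    assume "u' \<in> restr A ` {u\<in>B. adeg A u = mindeg B A}"
      "v' \<in> restr A ` {u\<in>B. adeg A u = mindeg B A}" and less: "lookup v' i < lookup u' i"
    then obtain u v where u: "u \<in> B" "adeg A u = mindeg B A" "u' = restr A u"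
      and v: "v \<in> B" "adeg A v = mindeg B A" "v' = restr A v" by blast
    have iA: "i \<in> A" and i: "lookup v i < lookup u i"
      using less u v by (auto simp: lookup_restr[OF fin] split: if_splits)
    obtain j where j: "lookup u j < lookup v j" "move i j u \<in> B"
      using exchange[OF u(1) v(1) i] by blast
    have "adeg A (move i j u) + 1 = adeg A u + (if j \<in> A then 1 else 0)"
      using adeg_move[OF fin, of u i j] i iA by simp
    then have jA: "j \<in> A" and "adeg A (move i j u) = mindeg B A"
      using mindeg_le[OF j(2), of A] u(2) by (auto split: if_splits)
    moreover have "restr A (move i j u) = move i j (restr A u)"
      by (rule poly_mapping_eqI) (use iA jA in \<open>auto simp: lookup_restr[OF fin] lookup_move\<close>)
    ultimately show "\<exists>j. lookup u' j < lookup v' j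
        \<and> move i j u' \<in> restr A ` {u\<in>B. adeg A u = mindeg B A}"
      using j u v by (intro exI[of _ j]) (force simp: lookup_restr[OF fin] image_iff)
  qed (use fin finite_family in \<open>auto simp: keys_restr tdeg_restr dest: subsetD[OF keys_restr]\<close>)
qed

text \<open>
The restrictions of all bases generate the localization; those of minimal degree already do so, since
every base lies above a minimizer on \<open>A\<close>.
\<close>

lemma (in exchange_family) dominates_restr_iff:
  assumes A: "A \<subseteq> V" and m: "keys m \<subseteq> A"
  shows "(\<exists>u\<in>restr A ` {u\<in>B. adeg A u = mindeg B A}. cle u m) \<longleftrightarrow> (\<exists>u\<in>B. cle (restr A u) m)"
proof -
  have fin: "finite A" using A finite_ground finite_subset by blast
  have "\<exists>v\<in>B. adeg A v = mindeg B A \<and> cle (restr A v) m"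
    if u: "u \<in> B" "cle (restr A u) m" for u
  proof -
    obtain v where v: "v \<in> B" "adeg A v = mindeg B A" "\<And>i. i \<in> A \<Longrightarrow> lookup v i \<le> lookup u i"
      using minimizer_below[OF A u(1)] by blast
    have "cle (restr A v) (restr A u)"
      using v(3) by (simp add: cle_def lookup_restr[OF fin])
    then show ?thesis using v u(2) cle_trans by blast
  qed
  then show ?thesis by blast
qed

text \<open>
Remove a unit of \<open>i\<close> from \<open>u\<close> and augment the result towards \<open>v\<close>. The vector obtained may be larger than
a single exchange of \<open>u\<close>, which is why downward closure is used once more.
\<close>

lemma exchange_family_bases:
  assumes V: "finite V" and P: "discrete_polymatroid V P"
  shows "exchange_family V (bases P) (Max (tdeg ` P))"
proof -
  have fin: "finite P" and ne: "P \<noteq> {}" and gr: "\<And>u. u \<in> P \<Longrightarrow> keys u \<subseteq> V"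
    and down: "\<And>u v. u \<in> P \<Longrightarrow> cle v u \<Longrightarrow> v \<in> P"
    and augment: "\<And>u v. u \<in> P \<Longrightarrow> v \<in> P \<Longrightarrow> tdeg u < tdeg v \<Longrightarrow>
        \<exists>w\<in>P. cle u w \<and> u \<noteq> w \<and> (\<forall>i. lookup w i \<le> max (lookup u i) (lookup v i))"
    using P unfolding discrete_polymatroid_def by auto
  have base_iff: "u \<in> bases P \<longleftrightarrow> u \<in> P \<and> tdeg u = Max (tdeg ` P)" for u
  proof -
    have "tdeg u = Max (tdeg ` P) \<longleftrightarrow> (\<forall>v\<in>P. tdeg v \<le> tdeg u)" if "u \<in> P"
      using that fin by (subst eq_commute, subst Max_eq_iff) auto
    then show ?thesis by (auto simp: bases_def)
  qed
  show ?thesis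
  proof
    show "bases P \<noteq> {}"
      using Max_in[of "tdeg ` P"] fin ne base_iff by fastforce
    fix u v i assume u: "u \<in> bases P" and v: "v \<in> bases P" and less: "lookup v i < lookup u i"
    let ?u = "u - Poly_Mapping.single i 1"
    have look: "lookup ?u k = lookup u k - (if k = i then 1 else 0)" for k
      by (auto simp: lookup_minus lookup_single when_def)
    have "?u + Poly_Mapping.single i 1 = u"
      by (rule cle_add_diff) (use less in \<open>auto simp: cle_def lookup_single when_def\<close>)
    then have deg: "tdeg ?u + 1 = tdeg u" by (metis tdeg_add tdeg_single)
    have "?u \<in> P" by (rule down[of u]) (use u base_iff look in \<open>auto simp: cle_def\<close>)
    then obtain w where w: "w \<in> P" "cle ?u w" "?u \<noteq> w"
        "\<And>k. lookup w k \<le> max (lookup ?u k) (lookup v k)"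
      using augment[of ?u v] v u deg base_iff by force
    obtain j where j: "lookup ?u j < lookup w j"
      using w(2,3) unfolding cle_def by (metis antisym leI poly_mapping_eqI)
    have jv: "lookup ?u j < lookup v j" using j w(4)[of j] by auto
    then have "j \<noteq> i" using less look[of i] by auto
    moreover have "move i j u \<in> P"
      by (rule down[OF w(1)])
         (use w(2) j in \<open>auto simp: cle_def move_def lookup_add look lookup_single when_def Suc_le_eq\<close>)
    ultimately show "\<exists>j. lookup u j < lookup v j \<and> move i j u \<in> bases P"
      using jv less u look[of j] tdeg_move[of u i j] base_iff by (intro exI[of _ j]) auto
  next
    show "finite (bases P)" using fin by (simp add: bases_def)
    show "finite V" by (rule V)
    show "keys u \<subseteq> V" if "u \<in> bases P" for u using that gr base_iff by blast
    show "tdeg u = Max (tdeg ` P)" if "u \<in> bases P" for u using that base_iff by blast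
  qed
qed

section \<open>Monomial ideals and powers of monomial primes\<close>

text \<open>
Since all ideals that occur are spanned by monomials, they are described by the set of exponents that are
allowed to occur; ideal membership then becomes a statement about exponents.
\<close>

definition supported :: "expo set \<Rightarrow> 'k::field mpol set" where
  "supported U = {f. keys f \<subseteq> U}"

definition expos :: "nat set \<Rightarrow> expo set" where
  "expos V = {m. keys m \<subseteq> V}"

lemma expos_add: "l \<in> expos V \<Longrightarrow> m \<in> expos V \<Longrightarrow> l + m \<in> expos V"
  using keys_add[of l m] by (auto simp: expos_def)

lemma expos_zero [simp]: "0 \<in> expos V"
  by (simp add: expos_def)

lemma expos_single: "i \<in> V \<Longrightarrow> Poly_Mapping.single i c \<in> expos V"
  by (simp add: expos_def)

lemma expos_mono: "A \<subseteq> V \<Longrightarrow> expos A \<subseteq> expos V"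
  by (auto simp: expos_def)

lemma expos_lookup_zero: "m \<in> expos V \<Longrightarrow> i \<notin> V \<Longrightarrow> lookup m i = 0"
  by (auto simp: expos_def in_keys_iff)

lemma expos_cle: "cle u m \<Longrightarrow> m \<in> expos V \<Longrightarrow> u \<in> expos V"
  using cle_imp_keys by (auto simp: expos_def)

lemma expos_diff: "m \<in> expos V \<Longrightarrow> m - u \<in> expos V"
  by (rule expos_cle[of _ m]) (auto simp: cle_def lookup_minus)

lemma supported_zero [simp]: "0 \<in> supported U"
  by (simp add: supported_def)

lemma supported_add: "f \<in> supported U \<Longrightarrow> g \<in> supported U \<Longrightarrow> f + g \<in> supported U"
  using keys_add[of f g] by (auto simp: supported_def)

lemma supported_uminus: "f \<in> supported U \<Longrightarrow> - f \<in> supported U"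
  by (simp add: supported_def in_keys_iff subset_iff)

lemma supported_diff: "f \<in> supported U \<Longrightarrow> g \<in> supported U \<Longrightarrow> f - g \<in> supported U"
  using supported_add[of f U "- g"] supported_uminus[of g U] by (simp del: add_uminus_conv_diff add: diff_conv_add_uminus)

lemma supported_sum: "(\<And>x. x \<in> X \<Longrightarrow> f x \<in> supported U) \<Longrightarrow> sum f X \<in> supported U"
  by (induction X rule: infinite_finite_induct) (auto intro: supported_add)

lemma supported_mult:
  assumes "f \<in> supported U1" "g \<in> supported U2"
    and "\<And>l m. l \<in> U1 \<Longrightarrow> m \<in> U2 \<Longrightarrow> l + m \<in> U"
  shows "f * g \<in> supported U"
  using assms keys_mult[of f g] by (fastforce simp: supported_def)

lemma supported_mono: "U \<subseteq> W \<Longrightarrow> supported U \<subseteq> supported W"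
  by (auto simp: supported_def)

lemma supported_single: "m \<in> U \<Longrightarrow> Poly_Mapping.single m c \<in> supported U"
  by (simp add: supported_def)

lemma xpow_in_supported_iff: "(xpow m :: 'k::field mpol) \<in> supported U \<longleftrightarrow> m \<in> U"
  by (simp add: supported_def xpow_def)

lemma supported_expos_mult:
  "f \<in> supported (expos V) \<Longrightarrow> g \<in> supported (expos V) \<Longrightarrow> f * g \<in> supported (expos V)"
  by (rule supported_mult) (auto intro: expos_add)

lemma var_in_supported: "i \<in> V \<Longrightarrow> var i \<in> supported (expos V)"
  by (simp add: var_def xpow_in_supported_iff expos_single)

lemma sum_monomials: "f = (\<Sum>m\<in>keys f. Poly_Mapping.single m (lookup f m))"
  by (rule poly_mapping_eqI) (auto simp: lookup_sum lookup_single when_def in_keys_iff)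

lemma xpow_mult: "xpow l * xpow m = xpow (l + m)"
  by (simp add: xpow_def mult_single)

lemma xpow_zero [simp]: "xpow 0 = 1"
  by (simp add: xpow_def)

lemma single_eq_single_mult_xpow:
  "cle u m \<Longrightarrow> Poly_Mapping.single m c = Poly_Mapping.single (m - u) c * xpow u"
  by (simp add: xpow_def mult_single cle_add_diff)

lemma lookup_mult_xpow: "lookup (f * xpow l) (m + l) = lookup f m"
proof -
  have "f * xpow l = (\<Sum>k\<in>keys f. Poly_Mapping.single (k + l) (lookup f k))"
    by (subst sum_monomials[of f]) (simp add: sum_distrib_right xpow_def mult_single)
  then show ?thesis
    by (auto simp: lookup_sum lookup_single when_def in_keys_iff)
qed

lemma keys_mult_xpow: "keys (f * xpow l) = (\<lambda>m. m + l) ` keys f"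
proof -
  have "keys (f * xpow l) \<subseteq> (\<lambda>m. m + l) ` keys f"
    using keys_mult[of f "xpow l :: 'a mpol"] by (auto simp: xpow_def)
  then show ?thesis
    by (auto simp: in_keys_iff lookup_mult_xpow)
qed

lemma keys_mult_var: "keys (f * var i) = (\<lambda>m. m + Poly_Mapping.single i 1) ` keys f"
  by (simp add: var_def keys_mult_xpow)

text \<open>
The part of a polynomial formed by the monomials satisfying \<open>P\<close>; for conditions of the form
\<open>deg m = t\<close> these are the homogeneous components with respect to a grading.
\<close>

definition component :: "(expo \<Rightarrow> bool) \<Rightarrow> 'k::field mpol \<Rightarrow> 'k mpol" where
  "component P f = (\<Sum>m | m \<in> keys f \<and> P m. Poly_Mapping.single m (lookup f m))"

lemma lookup_component: "lookup (component P f) m = (if P m then lookup f m else 0)"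
  by (auto simp: component_def lookup_sum lookup_single when_def in_keys_iff)

lemma keys_component: "keys (component P f) = {m\<in>keys f. P m}"
  by (auto simp: in_keys_iff lookup_component split: if_splits)

lemma component_add: "component P (f + g) = component P f + component P g"
  by (rule poly_mapping_eqI) (simp add: lookup_component lookup_add)

lemma component_sum: "component P (sum f X) = (\<Sum>x\<in>X. component P (f x))"
  by (rule poly_mapping_eqI) (simp add: lookup_component lookup_sum sum.delta)

lemma component_all: "(\<And>m. m \<in> keys f \<Longrightarrow> P m) \<Longrightarrow> component P f = f"
  by (rule poly_mapping_eqI) (auto simp: lookup_component in_keys_iff)

lemma component_none: "(\<And>m. m \<in> keys f \<Longrightarrow> \<not> P m) \<Longrightarrow> component P f = 0"
  by (rule poly_mapping_eqI) (auto simp: lookup_component in_keys_iff)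

lemma component_split: "f = component P f + component (\<lambda>m. \<not> P m) f"
  by (rule poly_mapping_eqI) (simp add: lookup_component lookup_add)

lemma component_mult_homogeneous:
  fixes deg :: "expo \<Rightarrow> nat"
  assumes add: "\<And>l m. deg (l + m) = deg l + deg m" and f: "\<And>m. m \<in> keys f \<Longrightarrow> deg m = a"
  shows "component (\<lambda>m. deg m = a + t) (f * g) = f * component (\<lambda>m. deg m = t) g"
proof -
  let ?P = "\<lambda>m. deg m = t" and ?Q = "\<lambda>m. deg m = a + t"
  have "component ?Q (f * g)
      = component ?Q (f * component ?P g) + component ?Q (f * component (\<lambda>m. \<not> ?P m) g)"
    by (subst component_split[of g ?P]) (simp add: distrib_left component_add)
  also have "component ?Q (f * component ?P g) = f * component ?P g"
  proof (rule component_all)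
    fix m assume "m \<in> keys (f * component ?P g)"
    then show "?Q m"
      using keys_mult[of f "component ?P g"] f by (auto simp: keys_component add)
  qed
  also have "component ?Q (f * component (\<lambda>m. \<not> ?P m) g) = 0"
  proof (rule component_none)
    fix m assume "m \<in> keys (f * component (\<lambda>m. \<not> ?P m) g)"
    then show "\<not> ?Q m"
      using keys_mult[of f "component (\<lambda>m. \<not> ?P m) g"] f by (auto simp: keys_component add)
  qed
  finally show ?thesis by simp
qed

text \<open>
Lowest forms multiply, for any grading of the monomials.
\<close>

lemma component_mult_lowest:
  fixes deg :: "expo \<Rightarrow> nat"
  assumes add: "\<And>l m. deg (l + m) = deg l + deg m"
    and f: "\<And>m. m \<in> keys f \<Longrightarrow> a \<le> deg m" and g: "\<And>m. m \<in> keys g \<Longrightarrow> b \<le> deg m"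
  shows "component (\<lambda>m. deg m = a + b) (f * g)
       = component (\<lambda>m. deg m = a) f * component (\<lambda>m. deg m = b) g"
proof -
  let ?f = "component (\<lambda>m. deg m = a) f" and ?f' = "component (\<lambda>m. deg m \<noteq> a) f"
  let ?Q = "\<lambda>m. deg m = a + b"
  have "component ?Q (f * g) = component ?Q (?f * g) + component ?Q (?f' * g)"
    by (subst component_split[of f "\<lambda>m. deg m = a"]) (simp add: distrib_right component_add)
  also have "component ?Q (?f' * g) = 0"
  proof (rule component_none)
    fix m assume "m \<in> keys (?f' * g)"
    then obtain k l where "k \<in> keys f" "deg k \<noteq> a" "l \<in> keys g" "m = k + l"
      using keys_mult[of ?f' g] by (auto simp: keys_component)
    then show "\<not> ?Q m" using f[of k] g[of l] by (simp add: add)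
  qed
  also have "component ?Q (?f * g) = ?f * component (\<lambda>m. deg m = b) g"
    by (rule component_mult_homogeneous[of deg ?f a b g]) (auto simp: add keys_component)
  finally show ?thesis by simp
qed

text \<open>
In contrapositive form: the powers of the prime generated by \<open>A\<close> are primary. The lowest form of \<open>f\<close> for the
degree in \<open>A\<close> and the part of \<open>g\<close> of degree 0 are both nonzero, hence so is their product, and
it is the lowest form of \<open>f * g\<close>.
\<close>

lemma primary_cancel:
  fixes f g :: "'k::field mpol"
  assumes f: "m \<in> keys f" "adeg A m < k" and g: "l \<in> keys g" "adeg A l = 0"
  shows "\<exists>m\<in>keys (f * g). adeg A m < k"
proof -
  define a where "a = Min (adeg A ` keys f)"
  have a_le: "a \<le> adeg A m" if "m \<in> keys f" for m
    unfolding a_def using that by simp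
  have "a \<in> adeg A ` keys f" unfolding a_def using f(1) by (intro Min_in) auto
  then obtain m' where m': "m' \<in> keys f" "adeg A m' = a" by blast
  have "component (\<lambda>m. adeg A m = a + 0) (f * g)
      = component (\<lambda>m. adeg A m = a) f * component (\<lambda>m. adeg A m = 0) g"
    by (rule component_mult_lowest) (auto simp: adeg_add a_le)
  moreover have "component (\<lambda>m. adeg A m = a) f \<noteq> 0" "component (\<lambda>m. adeg A m = 0) g \<noteq> 0"
    using m' g by (auto simp flip: keys_eq_empty simp: keys_component)
  ultimately have "component (\<lambda>m. adeg A m = a) (f * g) \<noteq> 0" by simp
  then have "{m \<in> keys (f * g). adeg A m = a} \<noteq> {}"
    by (auto simp flip: keys_eq_empty simp: keys_component)
  then show ?thesis using a_le[OF f(1)] f(2) by fastforce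
qed

lemma carrier_mpoly_ring: "carrier (mpoly_ring V) = supported (expos V)"
  by (auto simp: mpoly_ring_def supported_def expos_def)

lemma mpoly_ring_simps [simp]:
  "x \<otimes>\<^bsub>mpoly_ring V\<^esub> y = x * y" "\<one>\<^bsub>mpoly_ring V\<^esub> = 1"
  "x \<oplus>\<^bsub>mpoly_ring V\<^esub> y = x + y" "\<zero>\<^bsub>mpoly_ring V\<^esub> = 0"
  by (simp_all add: mpoly_ring_def)

lemma one_in_supported: "1 \<in> supported (expos V)"
  by (simp add: supported_def)

lemma cring_mpoly_ring: "cring (mpoly_ring V :: 'k::field mpol ring)"
proof (rule cringI)
  show "abelian_group (mpoly_ring V :: 'k mpol ring)"
    by (rule abelian_groupI)
       (auto simp: carrier_mpoly_ring supported_add add.assoc add.commute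
             intro!: bexI[of _ "- _"] supported_uminus)
  show "comm_monoid (mpoly_ring V :: 'k mpol ring)"
    by (rule comm_monoidI)
       (auto simp: carrier_mpoly_ring supported_expos_mult one_in_supported mult.assoc mult.commute)
qed (simp add: distrib_right)

lemma a_inv_mpoly_ring: "x \<in> supported (expos V) \<Longrightarrow> \<ominus>\<^bsub>mpoly_ring V\<^esub> x = - x"
proof -
  assume x: "x \<in> supported (expos V)"
  interpret cring "mpoly_ring V" by (rule cring_mpoly_ring)
  show ?thesis
    by (rule minus_equality) (use x in \<open>simp_all add: carrier_mpoly_ring supported_uminus\<close>)
qed

lemma ideal_supported:
  assumes "U \<subseteq> expos V" and up: "\<And>l m. l \<in> expos V \<Longrightarrow> m \<in> U \<Longrightarrow> l + m \<in> U"
  shows "ideal (supported U :: 'k::field mpol set) (mpoly_ring V)"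
proof -
  interpret cring "mpoly_ring V :: 'k mpol ring" by (rule cring_mpoly_ring)
  note sub = subsetD[OF supported_mono[OF assms(1)]]
  show ?thesis
  proof (rule idealI[OF ring_axioms])
    show "subgroup (supported U) (add_monoid (mpoly_ring V :: 'k mpol ring))"
    proof (rule subgroup.intro)
      fix x :: "'k mpol" assume x: "x \<in> supported U"
      then show "inv\<^bsub>add_monoid (mpoly_ring V)\<^esub> x \<in> supported U"
        using a_inv_mpoly_ring[OF sub[OF x]] by (simp add: a_inv_def supported_uminus)
    qed (auto simp: carrier_mpoly_ring supported_add sub)
  next
    fix a x :: "'k mpol"
    assume "a \<in> supported U" "x \<in> carrier (mpoly_ring V)"
    then show "x \<otimes>\<^bsub>mpoly_ring V\<^esub> a \<in> supported U"
      by (auto simp: carrier_mpoly_ring up intro: supported_mult)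
    then show "a \<otimes>\<^bsub>mpoly_ring V\<^esub> x \<in> supported U" by (simp add: mult.commute)
  qed
qed

lemma ideal_sum_closed:
  assumes "ideal J (mpoly_ring V :: 'k::field mpol ring)" "\<And>x. x \<in> X \<Longrightarrow> f x \<in> J"
  shows "sum f X \<in> J"
proof -
  interpret ideal J "mpoly_ring V" by fact
  have "0 \<in> J" "\<And>x y. x \<in> J \<Longrightarrow> y \<in> J \<Longrightarrow> x + y \<in> J"
    using additive_subgroup.zero_closed[OF is_additive_subgroup]
      additive_subgroup.a_closed[OF is_additive_subgroup] by auto
  then show ?thesis
    using assms(2) by (induction X rule: infinite_finite_induct) auto
qed

lemma genideal_xpow:
  assumes M: "M \<subseteq> expos V"
  shows "Idl\<^bsub>mpoly_ring V\<^esub> ((xpow :: expo \<Rightarrow> 'k::field mpol) ` M)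
       = supported {m\<in>expos V. \<exists>u\<in>M. cle u m}" (is "?J = ?S")
proof
  interpret cring "mpoly_ring V :: 'k mpol ring" by (rule cring_mpoly_ring)
  have carr: "(xpow :: expo \<Rightarrow> 'k mpol) ` M \<subseteq> carrier (mpoly_ring V)"
    using M by (auto simp: carrier_mpoly_ring xpow_in_supported_iff)
  show "?J \<subseteq> ?S"
  proof (rule genideal_minimal)
    show "ideal ?S (mpoly_ring V)"
      by (rule ideal_supported) (auto intro: expos_add cle_trans[OF _ cle_add])
    show "xpow ` M \<subseteq> ?S"
      using M by (auto simp: xpow_in_supported_iff) (auto simp: cle_def)
  qed
  interpret J: ideal ?J "mpoly_ring V" by (rule genideal_ideal[OF carr])
  show "?S \<subseteq> ?J"
  proof
    fix f :: "'k mpol" assume f: "f \<in> ?S"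
    have "Poly_Mapping.single m (lookup f m) \<in> ?J" if mem: "m \<in> keys f" for m
    proof -
      obtain u where u: "u \<in> M" "cle u m" and m: "m \<in> expos V"
        using f mem unfolding supported_def by blast
      have "Poly_Mapping.single (m - u) (lookup f m) \<in> carrier (mpoly_ring V)"
        using m by (auto simp: carrier_mpoly_ring intro: supported_single expos_diff)
      then show ?thesis
        using J.I_l_closed[of "xpow u" "Poly_Mapping.single (m - u) (lookup f m)"]
          subsetD[OF genideal_self[OF carr], of "xpow u"] u(1)
          single_eq_single_mult_xpow[OF u(2), of "lookup f m"]
        by (simp only: mpoly_ring_simps imageI)
    qed
    then have "(\<Sum>m\<in>keys f. Poly_Mapping.single m (lookup f m)) \<in> ?J"
      by (rule ideal_sum_closed[OF J.is_ideal])
    then show "f \<in> ?J" by (simp flip: sum_monomials)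
  qed
qed

lemma var_ideal_eq:
  assumes "A \<subseteq> V"
  shows "(var_ideal V A :: 'k::field mpol set)
       = supported {m\<in>expos V. \<exists>i\<in>A. 0 < lookup m i}"
proof -
  have "(var_ideal V A :: 'k mpol set)
      = Idl\<^bsub>mpoly_ring V\<^esub> (xpow ` (\<lambda>i. Poly_Mapping.single i 1) ` A)"
    by (simp add: var_ideal_def var_def image_image)
  also have "\<dots> = supported {m\<in>expos V. \<exists>i\<in>A. 0 < lookup m i}"
    using assms
    by (subst genideal_xpow) (auto simp: expos_single cle_def lookup_single when_def Suc_le_eq)
  finally show ?thesis .
qed

lemma adeg_pos_iff: "finite A \<Longrightarrow> 0 < adeg A m \<longleftrightarrow> (\<exists>i\<in>A. 0 < lookup m i)"
  by (simp flip: neq0_conv add: adeg_def)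

lemma var_ideal_eq_adeg:
  assumes "A \<subseteq> V" "finite A"
  shows "(var_ideal V A :: 'k::field mpol set) = supported {m\<in>expos V. 0 < adeg A m}"
  by (simp add: var_ideal_eq assms adeg_pos_iff)

text \<open>
The inclusion from right to left splits off from each monomial of degree greater than \<open>k\<close> in \<open>A\<close> a variable
belonging to \<open>A\<close>.
\<close>

lemma var_ideal_power:
  assumes A: "A \<subseteq> V" "finite A"
  shows "(var_ideal V A :: 'k::field mpol set) [^]\<^bsub>ideals_set (mpoly_ring V)\<^esub> (k::nat)
       = supported {m\<in>expos V. k \<le> adeg A m}" (is "_ = ?S k")
proof (induction k)
  case 0
  show ?case by (simp add: nat_pow_def ideals_set_def carrier_mpoly_ring)
next
  case (Suc k)
  interpret cring "mpoly_ring V :: 'k mpol ring" by (rule cring_mpoly_ring)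
  have id: "ideal (?S k) (mpoly_ring V)" for k
    by (rule ideal_supported) (auto intro: expos_add simp: adeg_add)
  have "(var_ideal V A :: 'k mpol set) [^]\<^bsub>ideals_set (mpoly_ring V)\<^esub> Suc k
      = ideal_prod (mpoly_ring V) (?S k) (var_ideal V A)"
    using Suc.IH by (simp add: nat_pow_def ideals_set_def)
  also have "\<dots> = ideal_prod (mpoly_ring V) (?S k) (?S 1)"
    by (simp add: var_ideal_eq_adeg A Suc_le_eq)
  also have "\<dots> = ?S (Suc k)"
  proof
    show "ideal_prod (mpoly_ring V) (?S k) (?S 1) \<subseteq> (?S (Suc k) :: 'k mpol set)"
    proof
      fix f :: "'k mpol" assume "f \<in> ideal_prod (mpoly_ring V) (?S k) (?S 1)"
      then show "f \<in> ?S (Suc k)"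
      proof (induction rule: ideal_prod.induct)
        case (prod i j)
        then show ?case by (auto intro!: supported_mult[of i _ j] expos_add simp: adeg_add)
      qed (simp add: supported_add)
    qed
    have P: "ideal (ideal_prod (mpoly_ring V) (?S k) (?S 1)) (mpoly_ring V :: 'k mpol ring)"
      by (rule ideal_prod_is_ideal[OF id id])
    show "(?S (Suc k) :: 'k mpol set) \<subseteq> ideal_prod (mpoly_ring V) (?S k) (?S 1)"
    proof
      fix f :: "'k mpol" assume f: "f \<in> ?S (Suc k)"
      have "Poly_Mapping.single m (lookup f m) \<in> ideal_prod (mpoly_ring V) (?S k) (?S 1)"
        if "m \<in> keys f" for m
      proof -
        have m: "m \<in> expos V" "Suc k \<le> adeg A m" using f that by (auto simp: supported_def)
        then obtain i where i: "i \<in> A" "0 < lookup m i"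
          using adeg_pos_iff[OF A(2), of m] by auto
        let ?e = "Poly_Mapping.single i (1::nat)"
        have c: "cle ?e m" using i by (simp add: cle_def lookup_single when_def)
        then have "adeg A (m - ?e) + 1 = adeg A m"
          using arg_cong[OF cle_add_diff[OF c], of "adeg A"] i A
          by (simp add: adeg_add adeg_single)
        then have "Poly_Mapping.single (m - ?e) (lookup f m) \<in> ?S k"
          using m by (intro supported_single) (auto intro: expos_diff)
        moreover have "(xpow ?e :: 'k mpol) \<in> ?S 1"
          using i A by (auto simp: xpow_in_supported_iff adeg_single expos_single)
        ultimately show ?thesis
          using ideal_prod.prod[of "Poly_Mapping.single (m - ?e) (lookup f m)" "?S k"
              "xpow ?e" "?S 1" "mpoly_ring V"] single_eq_single_mult_xpow[OF c, of "lookup f m"]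
          by (simp only: mpoly_ring_simps)
      qed
      then have "(\<Sum>m\<in>keys f. Poly_Mapping.single m (lookup f m))
          \<in> ideal_prod (mpoly_ring V) (?S k) (?S 1)"
        by (rule ideal_sum_closed[OF P])
      then show "f \<in> ideal_prod (mpoly_ring V) (?S k) (?S 1)" by (simp flip: sum_monomials)
    qed
  qed
  finally show ?case .
qed

lemma var_in_var_ideal_iff:
  assumes "A \<subseteq> V" "i \<in> V"
  shows "(var i :: 'k::field mpol) \<in> var_ideal V A \<longleftrightarrow> i \<in> A"
  using assms
  by (auto simp: var_ideal_eq var_def xpow_in_supported_iff expos_single lookup_single when_def)

lemma prime_vars_var_ideal:
  assumes "A \<subseteq> V"
  shows "prime_vars V (var_ideal V A :: 'k::field mpol set) = A"
  using assms var_in_var_ideal_iff[OF assms, where 'k = 'k] unfolding prime_vars_def by blast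

lemma primeideal_var_ideal:
  assumes A: "A \<subseteq> V" "finite A"
  shows "primeideal (var_ideal V A :: 'k::field mpol set) (mpoly_ring V)"
proof -
  note eq = var_ideal_eq_adeg[OF A]
  have one: "(1 :: 'k mpol) \<notin> var_ideal V A" by (simp add: eq supported_def)
  show ?thesis
  proof (rule primeidealI[OF _ cring_mpoly_ring])
    show "ideal (var_ideal V A :: 'k mpol set) (mpoly_ring V)"
      unfolding eq by (rule ideal_supported) (auto intro: expos_add simp: adeg_add)
    show "carrier (mpoly_ring V) \<noteq> (var_ideal V A :: 'k mpol set)"
      using one one_in_supported carrier_mpoly_ring by metis
    fix f g :: "'k mpol"
    assume f: "f \<in> carrier (mpoly_ring V)" and g: "g \<in> carrier (mpoly_ring V)"
      and fg: "f \<otimes>\<^bsub>mpoly_ring V\<^esub> g \<in> var_ideal V A"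
    show "f \<in> var_ideal V A \<or> g \<in> var_ideal V A"
    proof (rule ccontr)
      assume "\<not> ?thesis"
      then obtain l m where "l \<in> keys f" "adeg A l = 0" "m \<in> keys g" "adeg A m = 0"
        using f g by (force simp: eq supported_def carrier_mpoly_ring)
      then show False
        using primary_cancel[of l f A 1 m g] fg by (auto simp: eq supported_def)
    qed
  qed
qed

lemma monomial_prime_var_ideal:
  "A \<subseteq> V \<Longrightarrow> finite A \<Longrightarrow> monomial_prime V (var_ideal V A :: 'k::field mpol set)"
  unfolding monomial_prime_def using primeideal_var_ideal by blast

section \<open>Monomial localization\<close>

lemma xpow_sum: "finite X \<Longrightarrow> xpow (\<Sum>x\<in>X. f x) = (\<Prod>x\<in>X. xpow (f x))"
  by (induction X rule: finite_induct) (simp_all flip: xpow_mult)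

lemma var_power: "var i ^ c = xpow (Poly_Mapping.single i c)"
  by (induction c) (simp_all add: var_def xpow_mult flip: single_add)

lemma loc_hom_eq:
  assumes A: "finite A"
  shows "loc_hom A f = (\<Sum>m\<in>keys f. Poly_Mapping.single (restr A m) (lookup f m))"
proof -
  have "(\<Prod>i\<in>keys m. (if i \<in> A then var i else 1) ^ lookup m i) = (xpow (restr A m) :: 'a mpol)"
    for m
  proof -
    have "(\<Prod>i\<in>keys m. (if i \<in> A then var i else 1) ^ lookup m i)
        = (\<Prod>i\<in>keys m \<inter> A. xpow (Poly_Mapping.single i (lookup m i)) :: 'a mpol)"
      by (rule prod.mono_neutral_cong_right) (auto simp: var_power)
    also have "\<dots> = (\<Prod>i\<in>A. xpow (Poly_Mapping.single i (lookup m i)))"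
    proof (rule prod.mono_neutral_left)
      show "\<forall>i\<in>A - keys m \<inter> A. xpow (Poly_Mapping.single i (lookup m i)) = (1 :: 'a mpol)"
      proof
        fix i assume "i \<in> A - keys m \<inter> A"
        then have "lookup m i = 0" by (auto simp: in_keys_iff)
        then show "xpow (Poly_Mapping.single i (lookup m i)) = (1 :: 'a mpol)" by simp
      qed
    qed (use A in auto)
    also have "\<dots> = xpow (restr A m)" by (simp add: restr_def xpow_sum A)
    finally show ?thesis .
  qed
  then show ?thesis by (simp add: loc_hom_def xpow_def mult_single)
qed

text \<open>
For the inclusion from right to left, a polynomial \<open>f\<close> over \<open>A\<close> is multiplied by a monomial in the
remaining variables that is large enough to supply the missing parts of all exponents in \<open>B\<close>; the
homomorphism maps the product back to \<open>f\<close>.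
\<close>

lemma loc_hom_image:
  assumes V: "finite V" and A: "A \<subseteq> V" and B: "finite B" "B \<subseteq> expos V"
  shows "loc_hom A ` supported {m\<in>expos V. \<exists>u\<in>B. cle u m}
       = (supported {m\<in>expos A. \<exists>u\<in>B. cle (restr A u) m} :: 'k::field mpol set)"
    (is "_ ` ?S = ?T")
proof
  have fin: "finite A" using assms finite_subset by blast
  show "loc_hom A ` ?S \<subseteq> ?T"
  proof clarify
    fix f :: "'k mpol" assume f: "f \<in> ?S"
    show "loc_hom A f \<in> ?T"
      unfolding loc_hom_eq[OF fin]
    proof (rule supported_sum, rule supported_single)
      fix m assume "m \<in> keys f"
      then obtain u where "u \<in> B" "cle u m" using f by (auto simp: supported_def)
      then show "restr A m \<in> {m\<in>expos A. \<exists>u\<in>B. cle (restr A u) m}"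
        using keys_restr[OF fin] by (auto simp: expos_def cle_def lookup_restr[OF fin])
    qed
  qed
  show "?T \<subseteq> loc_hom A ` ?S"
  proof
    fix f :: "'k mpol" assume f: "f \<in> ?T"
    define w where "w = restr (V - A) (\<Sum>u\<in>B. u)"
    have w: "lookup w i = (if i \<in> V - A then \<Sum>u\<in>B. lookup u i else 0)" for i
      using V by (simp add: w_def lookup_restr lookup_sum)
    have w_ge: "lookup u i \<le> lookup w i" if "u \<in> B" "i \<in> V - A" for u i
      using that B by (auto simp: w intro: member_le_sum[of u B "\<lambda>u. lookup u i"])
    have "loc_hom A (f * xpow w)
        = (\<Sum>m\<in>keys f. Poly_Mapping.single (restr A (m + w)) (lookup (f * xpow w) (m + w)))"
      unfolding loc_hom_eq[OF fin] keys_mult_xpow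
      by (subst sum.reindex) (auto simp: inj_on_def)
    also have "\<dots> = (\<Sum>m\<in>keys f. Poly_Mapping.single m (lookup f m))"
    proof (rule sum.cong)
      fix m assume "m \<in> keys f"
      then have "keys m \<subseteq> A" using f by (auto simp: supported_def expos_def)
      then have "restr A (m + w) = m"
        by (intro poly_mapping_eqI) (auto simp: lookup_restr[OF fin] lookup_add w in_keys_iff)
      then show "Poly_Mapping.single (restr A (m + w)) (lookup (f * xpow w) (m + w))
          = Poly_Mapping.single m (lookup f m)" by (simp add: lookup_mult_xpow)
    qed simp
    finally have loc: "loc_hom A (f * xpow w) = f" by (simp flip: sum_monomials)
    have "f * xpow w \<in> ?S"
    proof -
      have "m + w \<in> {m\<in>expos V. \<exists>u\<in>B. cle u m}" if mem: "m \<in> keys f" for m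
      proof -
        obtain u where u: "u \<in> B" "cle (restr A u) m" and m: "m \<in> expos A"
          using f mem unfolding supported_def by blast
        have "w \<in> expos V" using w by (auto simp: expos_def in_keys_iff split: if_splits)
        then have "m + w \<in> expos V" using m expos_mono[OF A] expos_add by blast
        moreover have "lookup u i \<le> lookup (m + w) i" for i
        proof (cases "i \<in> A")
          case True
          then show ?thesis
            using u(2) by (auto simp: cle_def lookup_restr[OF fin] lookup_add intro: trans_le_add1
                dest: spec[of _ i])
        next
          case False
          show ?thesis
          proof (cases "i \<in> V")
            case True
            then show ?thesis using w_ge[OF u(1), of i] False by (simp add: lookup_add)
          next
            case False
            then have "lookup u i = 0" using u(1) B(2) expos_lookup_zero by blast
            then show ?thesis by simp
          qed
        qed
        ultimately show ?thesis using u(1) by (auto simp: cle_def)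
      qed
      then show ?thesis by (auto simp: supported_def keys_mult_xpow)
    qed
    then show "f \<in> loc_hom A ` ?S" by (rule rev_image_eqI) (simp add: loc)
  qed
qed

section \<open>Associated primes and the irredundant presentation\<close>

lemma xpow_in_prime:
  assumes p: "primeideal p (mpoly_ring V :: 'k::field mpol ring)"
    and m: "m \<in> expos V" "(xpow m :: 'k mpol) \<in> p"
  shows "\<exists>i\<in>keys m. (var i :: 'k mpol) \<in> p"
  using m
proof (induction "tdeg m" arbitrary: m rule: less_induct)
  case less
  interpret primeideal p "mpoly_ring V" by (rule p)
  have "m \<noteq> 0"
    using less.prems(2) one_imp_carrier I_notcarr by auto
  then obtain i where i: "i \<in> keys m" by (metis keys_eq_empty ex_in_conv)
  let ?e = "Poly_Mapping.single i (1::nat)"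
  have "cle ?e m" using i by (auto simp: cle_def lookup_single when_def in_keys_iff)
  then have eq: "(m - ?e) + ?e = m" by (rule cle_add_diff)
  have less': "tdeg (m - ?e) < tdeg m"
    using arg_cong[OF eq, of tdeg] by (simp add: tdeg_add tdeg_single)
  have e: "?e \<in> expos V" using i less.prems(1) by (auto simp: expos_def)
  have me: "m - ?e \<in> expos V" using less.prems(1) by (rule expos_diff)
  have "(xpow (m - ?e) :: 'k mpol) * var i \<in> p"
    using less.prems(2) eq by (simp add: var_def xpow_mult)
  then have "(xpow (m - ?e) :: 'k mpol) \<in> p \<or> (var i :: 'k mpol) \<in> p"
    using I_prime[of "xpow (m - ?e)" "var i"] e me
    by (auto simp: carrier_mpoly_ring xpow_in_supported_iff var_def)
  moreover have "keys (m - ?e) \<subseteq> keys m"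
    by (rule cle_imp_keys) (simp add: cle_def lookup_minus)
  ultimately show ?case using less.hyps[OF less' me] i by blast
qed

lemma powers_inter_var_ideals:
  assumes "\<And>A. A \<in> G \<Longrightarrow> A \<subseteq> V \<and> finite A"
  shows "powers_inter (mpoly_ring V) ((\<lambda>A. (var_ideal V A :: 'k::field mpol set, e A)) ` G)
       = supported {m\<in>expos V. \<forall>A\<in>G. e A \<le> adeg A m}"
  unfolding powers_inter_def carrier_mpoly_ring
  using assms by (auto simp: var_ideal_power supported_def)

context exchange_family
begin

text \<open>
A family of subsets whose conditions on the degrees already force \<open>w\<close> to dominate a base, that is, a
presentation of the ideal as an intersection of powers of primes.
\<close>

definition determining :: "nat set set \<Rightarrow> bool" where
  "determining F \<longleftrightarrow> F \<subseteq> Pow V \<and> (\<forall>A\<in>F. 0 < mindeg B A) \<and>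
     (\<forall>w. (\<forall>A\<in>F. mindeg B A \<le> adeg A w) \<longrightarrow> (\<exists>u\<in>B. cle u w))"

lemma minimal_determining: "\<exists>F. determining F \<and> (\<forall>G. G \<subset> F \<longrightarrow> \<not> determining G)"
proof -
  have "determining {A\<in>Pow V. 0 < mindeg B A}"
    unfolding determining_def dominates_base_iff
  proof (intro conjI allI impI)
    fix w A assume w: "\<forall>A\<in>{A \<in> Pow V. 0 < mindeg B A}. mindeg B A \<le> adeg A w" and "A \<subseteq> V"
    then show "mindeg B A \<le> adeg A w" by (cases "mindeg B A = 0") auto
  qed auto
  then obtain F where F: "determining F" "\<And>G. determining G \<Longrightarrow> card F \<le> card G"
    using ex_has_least_nat[of determining _ card] by blast
  have "finite F"
    using F(1) finite_ground finite_subset unfolding determining_def by blast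
  then have "\<not> determining G" if "G \<subset> F" for G
    using F(2)[of G] psubset_card_mono[OF _ that] by auto
  then show ?thesis using F(1) by blast
qed

abbreviation base_ideal :: "'k::field mpol set" where
  "base_ideal \<equiv> supported {m\<in>expos V. \<exists>u\<in>B. cle u m}"

lemma finite_sub: "A \<subseteq> V \<Longrightarrow> finite A"
  using finite_ground finite_subset by blast

lemma determining_iff:
  assumes "determining F"
  shows "(\<exists>u\<in>B. cle u w) \<longleftrightarrow> (\<forall>A\<in>F. mindeg B A \<le> adeg A w)"
proof
  assume "\<exists>u\<in>B. cle u w"
  then show "\<forall>A\<in>F. mindeg B A \<le> adeg A w"
    using assms by (auto simp: determining_def dominates_base_iff)
next
  assume "\<forall>A\<in>F. mindeg B A \<le> adeg A w"
  then show "\<exists>u\<in>B. cle u w" using assms unfolding determining_def by blast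
qed

text \<open>
As \<open>A\<close> cannot be omitted from the family, some \<open>w\<close> violates the condition for \<open>A\<close> and no other one.
Multiplying it by a power of a variable in \<open>A\<close> raises its degree in \<open>A\<close> to one less than required.
\<close>

lemma critical_exponent:
  assumes F: "determining F" "\<And>G. G \<subset> F \<Longrightarrow> \<not> determining G" and A: "A \<in> F"
  shows "\<exists>w\<in>expos V. (\<forall>C\<in>F - {A}. mindeg B C \<le> adeg C w) \<and> Suc (adeg A w) = mindeg B A"
proof -
  have AV: "A \<subseteq> V" and FV: "\<And>C. C \<in> F \<Longrightarrow> C \<subseteq> V" and pos: "0 < mindeg B A"
    using F(1) A by (auto simp: determining_def)
  have "\<not> determining (F - {A})" using F(2)[of "F - {A}"] A by blast
  moreover have "F - {A} \<subseteq> Pow V \<and> (\<forall>C\<in>F - {A}. 0 < mindeg B C)"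
    using F(1) by (auto simp: determining_def)
  ultimately have "\<not> (\<forall>w. (\<forall>C\<in>F - {A}. mindeg B C \<le> adeg C w) \<longrightarrow> (\<exists>u\<in>B. cle u w))"
    unfolding determining_def by argo
  then obtain w where w: "\<forall>C\<in>F - {A}. mindeg B C \<le> adeg C w" "\<not> (\<exists>u\<in>B. cle u w)"
    by blast
  have lt: "adeg A w < mindeg B A"
  proof (rule ccontr)
    assume "\<not> adeg A w < mindeg B A"
    then have "mindeg B C \<le> adeg C w" if "C \<in> F" for C
      using w(1) that by (cases "C = A") auto
    then show False using w(2) determining_iff[OF F(1), of w] by simp
  qed
  obtain u where "u \<in> B" "adeg A u = mindeg B A" using mindeg_attained by blast
  then obtain a where a: "a \<in> A" using pos by (fastforce simp: adeg_def)
  \<comment> \<open>The exponent w may involve indices outside the ground set, which have to be discarded.\<close>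
  let ?w = "restr V w + Poly_Mapping.single a (mindeg B A - 1 - adeg A w)"
  have restr: "adeg C (restr V w) = adeg C w" if "C \<subseteq> V" for C
    using that unfolding adeg_def by (intro sum.cong) (auto simp: lookup_restr finite_ground)
  have "?w \<in> expos V"
    using keys_restr[OF finite_ground] a AV
    by (intro expos_add expos_single) (auto simp: expos_def)
  moreover have "\<forall>C\<in>F - {A}. mindeg B C \<le> adeg C ?w"
    using w(1) FV by (auto simp: adeg_add restr intro: trans_le_add1)
  moreover have "Suc (adeg A ?w) = mindeg B A"
    using lt a AV by (simp add: adeg_add restr adeg_single finite_sub)
  ultimately show ?thesis by blast
qed

text \<open>
Multiplying a critical monomial by \<open>g\<close> gives an element of the ideal iff each monomial of \<open>g\<close> contributes at
least the one missing unit of degree in \<open>A\<close>.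
\<close>

lemma associated_var_ideal:
  assumes F: "determining F" "\<And>G. G \<subset> F \<Longrightarrow> \<not> determining G" and A: "A \<in> F"
  shows "(var_ideal V A :: 'k::field mpol set) \<in> associated_primes (mpoly_ring V) base_ideal"
proof -
  have AV: "A \<subseteq> V" using F(1) A by (auto simp: determining_def)
  obtain w where w: "w \<in> expos V" "\<forall>C\<in>F - {A}. mindeg B C \<le> adeg C w"
      "Suc (adeg A w) = mindeg B A"
    using critical_exponent[OF F A] by blast
  have in_iff: "(\<exists>u\<in>B. cle u (m + w)) \<longleftrightarrow> 0 < adeg A m" for m
  proof -
    have "(\<exists>u\<in>B. cle u (m + w)) \<longleftrightarrow> mindeg B A \<le> adeg A (m + w)"
      unfolding determining_iff[OF F(1)] using w(2) A
      by (auto simp: adeg_add intro: trans_le_add2)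
    then show ?thesis using w(3) by (auto simp: adeg_add)
  qed
  have "var_ideal V A
      = {g\<in>carrier (mpoly_ring V). g \<otimes>\<^bsub>mpoly_ring V\<^esub> xpow w \<in> (base_ideal :: 'k mpol set)}"
  proof -
    have "g \<in> var_ideal V A \<longleftrightarrow> g * xpow w \<in> base_ideal"
      if "g \<in> supported (expos V)" for g :: "'k mpol"
    proof -
      have "g * xpow w \<in> base_ideal \<longleftrightarrow> (\<forall>m\<in>keys g. m + w \<in> expos V \<and> 0 < adeg A m)"
        unfolding supported_def mem_Collect_eq keys_mult_xpow image_subset_iff in_iff ..
      then show ?thesis
        using that w(1)
        by (auto simp: var_ideal_eq_adeg[OF AV finite_sub[OF AV]] supported_def intro: expos_add)
    qed
    moreover have "g \<in> supported (expos V)" if "g \<in> var_ideal V A" for g :: "'k mpol"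
      using that by (auto simp: var_ideal_eq_adeg[OF AV finite_sub[OF AV]] supported_def)
    ultimately show ?thesis by (auto simp: carrier_mpoly_ring)
  qed
  moreover have "(xpow w :: 'k mpol) \<in> carrier (mpoly_ring V)"
    using w(1) by (simp add: carrier_mpoly_ring xpow_in_supported_iff)
  ultimately show ?thesis
    using primeideal_var_ideal[OF AV finite_sub[OF AV]] unfolding associated_primes_def by blast
qed

text \<open>
Let \<open>p\<close> be the annihilator of \<open>f\<close>. Some violated condition \<open>A\<close> has all its variables in \<open>p\<close>: otherwise a
monomial in variables outside \<open>p\<close>, one from each violated condition, would carry \<open>f\<close> into the ideal, while a
prime contains no such monomial. For this \<open>A\<close> the reverse inclusion holds because the powers of the prime
generated by \<open>A\<close> are primary.
\<close>

lemma associated_prime_cases: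
  assumes F: "determining F"
    and p: "p \<in> associated_primes (mpoly_ring V) (base_ideal :: 'k::field mpol set)"
  shows "p \<in> var_ideal V ` F"
proof -
  obtain f :: "'k mpol" where prime: "primeideal p (mpoly_ring V)"
    and f: "f \<in> supported (expos V)"
    and p_eq: "\<And>g. g \<in> p \<longleftrightarrow> g \<in> supported (expos V) \<and> g * f \<in> base_ideal"
    using p unfolding associated_primes_def carrier_mpoly_ring by auto
  interpret p: primeideal p "mpoly_ring V" by (rule prime)
  have FV: "A \<subseteq> V" if "A \<in> F" for A using F that by (auto simp: determining_def)
  have finF: "finite F"
    using F finite_ground finite_subset unfolding determining_def by blast
  define violated where "violated = {A\<in>F. \<exists>m\<in>keys f. adeg A m < mindeg B A}"
  have "\<exists>A\<in>violated. \<forall>i\<in>A. var i \<in> p"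
  proof (rule ccontr)
    assume "\<not> ?thesis"
    then obtain i where i: "\<And>A. A \<in> violated \<Longrightarrow> i A \<in> A \<and> var (i A) \<notin> p" by metis
    define w where "w = (\<Sum>A\<in>violated. Poly_Mapping.single (i A) (mindeg B A))"
    have keys_w: "keys w \<subseteq> i ` violated"
      unfolding w_def using keys_sum by (fastforce split: if_splits)
    have "w \<in> expos V"
      using keys_w i FV unfolding violated_def expos_def by fastforce
    moreover have "xpow w * f \<in> base_ideal"
    proof -
      have "\<exists>u\<in>B. cle u (m + w)" if m: "m \<in> keys f" for m
        unfolding determining_iff[OF F]
      proof
        fix A assume A: "A \<in> F"
        show "mindeg B A \<le> adeg A (m + w)"
        proof (cases "A \<in> violated")
          case True
          have "mindeg B A = adeg A (Poly_Mapping.single (i A) (mindeg B A))"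
            using i[OF True] finite_sub[OF FV[OF A]] by (simp add: adeg_single)
          also have "cle (Poly_Mapping.single (i A) (mindeg B A)) w"
            unfolding cle_def w_def lookup_sum
            using True finF by (auto simp: violated_def intro!: member_le_sum[of A])
          then have "adeg A (Poly_Mapping.single (i A) (mindeg B A)) \<le> adeg A w"
            by (rule adeg_mono)
          finally show ?thesis by (simp add: adeg_add)
        next
          case False
          then show ?thesis using A m by (fastforce simp: violated_def adeg_add)
        qed
      qed
      then show ?thesis
        using f \<open>w \<in> expos V\<close> unfolding mult.commute[of "xpow w"]
        by (auto simp: supported_def keys_mult_xpow intro: expos_add)
    qed
    ultimately have "xpow w \<in> p" by (simp add: p_eq xpow_in_supported_iff)
    then show False using xpow_in_prime[OF prime \<open>w \<in> expos V\<close>] keys_w i by blast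
  qed
  then obtain A m where A: "A \<in> F" "\<And>i. i \<in> A \<Longrightarrow> var i \<in> p"
    and m: "m \<in> keys f" "adeg A m < mindeg B A" unfolding violated_def by blast
  have "var_ideal V A \<subseteq> p"
    unfolding var_ideal_def by (rule p.genideal_minimal[OF p.is_ideal]) (use A in auto)
  moreover have "p \<subseteq> var_ideal V A"
  proof
    fix g assume g: "g \<in> p"
    show "g \<in> var_ideal V A"
    proof (rule ccontr)
      assume "g \<notin> var_ideal V A"
      then obtain l where "l \<in> keys g" "adeg A l = 0"
        using g p_eq[of g] by (auto simp: var_ideal_eq_adeg[OF FV[OF A(1)]
              finite_sub[OF FV[OF A(1)]]] supported_def)
      then obtain m' where "m' \<in> keys (f * g)" "adeg A m' < mindeg B A"
        using primary_cancel[OF m] by blast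
      moreover have "f * g \<in> base_ideal" using g p_eq[of g] by (simp add: mult.commute)
      ultimately show False
        using determining_iff[OF F, of m'] A(1) unfolding supported_def by force
    qed
  qed
  ultimately show ?thesis using A(1) by blast
qed

lemma associated_primes_base_ideal:
  assumes "determining F" "\<And>G. G \<subset> F \<Longrightarrow> \<not> determining G"
  shows "associated_primes (mpoly_ring V) (base_ideal :: 'k::field mpol set) = var_ideal V ` F"
  using associated_var_ideal[OF assms] associated_prime_cases[OF assms(1)] by blast

text \<open>
Irredundancy is checked on critical monomials: if the component of \<open>A\<close> is dropped, a critical monomial for
\<open>A\<close> belongs to the intersection but not to the ideal.
\<close>

lemma irredundant_presentation_base_ideal:
  "irredundant_presentation V (base_ideal :: 'k::field mpol set)
     ((\<lambda>p. (p, mindeg B (prime_vars V p))) ` associated_primes (mpoly_ring V) base_ideal)"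
proof -
  obtain F where F: "determining F" "\<And>G. G \<subset> F \<Longrightarrow> \<not> determining G"
    using minimal_determining by blast
  have FV: "A \<subseteq> V" "finite A" "0 < mindeg B A" if "A \<in> F" for A
    using F(1) that finite_sub by (auto simp: determining_def)
  have finF: "finite F"
    using F(1) finite_ground finite_subset unfolding determining_def by blast
  define \<phi> where "\<phi> A = (var_ideal V A :: 'k mpol set, mindeg B A)" for A
  have ass: "associated_primes (mpoly_ring V) (base_ideal :: 'k mpol set) = var_ideal V ` F"
    by (rule associated_primes_base_ideal[OF F])
  have eq: "(\<lambda>p. (p, mindeg B (prime_vars V p))) ` associated_primes (mpoly_ring V)
      (base_ideal :: 'k mpol set) = \<phi> ` F"
    unfolding ass image_image \<phi>_def
    by (rule image_cong) (simp_all add: prime_vars_var_ideal FV)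
  have inter: "powers_inter (mpoly_ring V) (\<phi> ` G)
      = supported {m\<in>expos V. \<forall>A\<in>G. mindeg B A \<le> adeg A m}" if "G \<subseteq> F" for G
    unfolding \<phi>_def by (rule powers_inter_var_ideals) (use FV that in blast)
  have "presentation V base_ideal (\<phi> ` F)"
    unfolding presentation_def
  proof (intro conjI)
    show "finite (\<phi> ` F)" using finF by simp
    show "\<forall>(p, k)\<in>\<phi> ` F. monomial_prime V p \<and> 0 < k"
      using FV by (auto simp: \<phi>_def intro!: monomial_prime_var_ideal)
    show "base_ideal = powers_inter (mpoly_ring V) (\<phi> ` F)"
      by (simp add: inter determining_iff[OF F(1)])
  qed
  moreover have "powers_inter (mpoly_ring V) G \<noteq> base_ideal" if G: "G \<subset> \<phi> ` F" for G
  proof -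
    define F' where "F' = {C\<in>F. \<phi> C \<in> G}"
    have G_eq: "G = \<phi> ` F'" using G by (auto simp: F'_def)
    obtain A where A: "A \<in> F" "A \<notin> F'" using G unfolding F'_def by blast
    obtain w where w: "w \<in> expos V" "\<forall>C\<in>F - {A}. mindeg B C \<le> adeg C w"
        "Suc (adeg A w) = mindeg B A"
      using critical_exponent[OF F A(1)] by blast
    have "(xpow w :: 'k mpol) \<in> powers_inter (mpoly_ring V) G"
      unfolding G_eq using w(1,2) A by (subst inter) (auto simp: xpow_in_supported_iff F'_def)
    moreover have "(xpow w :: 'k mpol) \<notin> base_ideal"
      using w(3) A(1) by (auto simp: xpow_in_supported_iff determining_iff[OF F(1)]
          intro!: bexI[of _ A])
    ultimately show ?thesis by blast
  qed
  ultimately show ?thesis unfolding irredundant_presentation_def eq by blast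
qed

lemma associated_prime_base_ideal_eq:
  assumes "p \<in> associated_primes (mpoly_ring V) (base_ideal :: 'k::field mpol set)"
  shows "\<exists>A\<subseteq>V. p = var_ideal V A"
proof -
  obtain F where F: "determining F" using minimal_determining by blast
  then show ?thesis
    using associated_prime_cases[OF F assms] unfolding determining_def by blast
qed

lemma monomial_localization_base_ideal:
  assumes A: "A \<subseteq> V"
  shows "monomial_localization V base_ideal (var_ideal V A)
       = (supported {m\<in>expos A. \<exists>u\<in>restr A ` {u\<in>B. adeg A u = mindeg B A}. cle u m}
           :: 'k::field mpol set)"
proof -
  have "monomial_localization V base_ideal (var_ideal V A)
      = (supported {m\<in>expos A. \<exists>u\<in>B. cle (restr A u) m} :: 'k::field mpol set)"
    unfolding monomial_localization_def prime_vars_var_ideal[OF A]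
    by (rule loc_hom_image) (use finite_ground finite_family A in_ground in \<open>auto simp: expos_def\<close>)
  also have "{m\<in>expos A. \<exists>u\<in>B. cle (restr A u) m}
      = {m\<in>expos A. \<exists>u\<in>restr A ` {u\<in>B. adeg A u = mindeg B A}. cle u m}"
    using dominates_restr_iff[OF A] unfolding expos_def by blast
  finally show ?thesis .
qed

end

section \<open>Linear quotients and their syzygies\<close>

text \<open>
A matrix with \<open>R\<close> rows and \<open>m\<close> columns is given here by its entry function \<open>F\<close>, and a vector by the function \<open>c\<close> of
its coordinates; values outside the index range are arbitrary.
\<close>

definition syzygy :: "nat set \<Rightarrow> nat \<Rightarrow> nat \<Rightarrow> (nat \<Rightarrow> nat \<Rightarrow> 'k::field mpol) \<Rightarrow> (nat \<Rightarrow> 'k mpol) \<Rightarrow> bool"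
  where "syzygy V R m F c \<longleftrightarrow>
    (\<forall>j<m. c j \<in> supported (expos V)) \<and> (\<forall>r<R. (\<Sum>j<m. F r j * c j) = 0)"

text \<open>
The elements \<open>c k\<close>, for syzygies \<open>c\<close> that vanish after position \<open>k\<close>, are those multiplying the \<open>k\<close>-th
column into the span of the preceding ones. The two conditions say that they form the ideal generated by the
variables in \<open>A\<close>.
\<close>

definition colon_variables ::
    "nat set \<Rightarrow> nat \<Rightarrow> nat \<Rightarrow> (nat \<Rightarrow> nat \<Rightarrow> 'k::field mpol) \<Rightarrow> nat \<Rightarrow> nat set \<Rightarrow> bool"
  where "colon_variables V R m F k A \<longleftrightarrow> A \<subseteq> V \<and>
    (\<forall>i\<in>A. \<exists>c. syzygy V R m F c \<and> c k = var i \<and> (\<forall>j<m. k < j \<longrightarrow> c j = 0)) \<and>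
    (\<forall>c. syzygy V R m F c \<longrightarrow> (\<forall>j<m. k < j \<longrightarrow> c j = 0) \<longrightarrow> c k \<in> var_ideal V A)"

definition linear_quotients :: "nat set \<Rightarrow> nat \<Rightarrow> nat \<Rightarrow> (nat \<Rightarrow> nat \<Rightarrow> 'k::field mpol) \<Rightarrow> bool"
  where "linear_quotients V R m F \<longleftrightarrow> (\<forall>k<m. \<exists>A. colon_variables V R m F k A)"

definition homogeneous_entries :: "nat set \<Rightarrow> nat \<Rightarrow> nat \<Rightarrow> nat \<Rightarrow> (nat \<Rightarrow> nat \<Rightarrow> 'k::field mpol) \<Rightarrow> bool"
  where "homogeneous_entries V e R m F \<longleftrightarrow>
    (\<forall>r<R. \<forall>j<m. F r j \<in> supported {l\<in>expos V. tdeg l = e})"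

lemma homogeneous_entriesD:
  assumes "homogeneous_entries V e R m F" "r < R" "j < m"
  shows "F r j \<in> supported (expos V)" "l \<in> keys (F r j) \<Longrightarrow> tdeg l = e"
  using assms unfolding homogeneous_entries_def supported_def by blast+

lemma syzygy_diff:
  assumes "syzygy V R m F c" "syzygy V R m F c'"
  shows "syzygy V R m F (\<lambda>j. c j - c' j)"
  using assms by (auto simp: syzygy_def right_diff_distrib sum_subtractf intro: supported_diff)

lemma syzygy_lincomb:
  assumes F: "homogeneous_entries V e R m F"
    and s: "\<And>q. q < M \<Longrightarrow> syzygy V R m F (\<lambda>j. F' j q)"
    and v: "\<And>q. q < M \<Longrightarrow> v q \<in> supported (expos V)"
  shows "syzygy V R m F (\<lambda>j. \<Sum>q<M. F' j q * v q)"
  unfolding syzygy_def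
proof (intro conjI allI impI)
  fix j assume "j < m"
  then show "(\<Sum>q<M. F' j q * v q) \<in> supported (expos V)"
    using s v by (intro supported_sum supported_expos_mult) (auto simp: syzygy_def)
next
  fix r assume r: "r < R"
  have "(\<Sum>j<m. F r j * (\<Sum>q<M. F' j q * v q)) = (\<Sum>q<M. (\<Sum>j<m. F r j * F' j q) * v q)"
    by (simp add: sum_distrib_left sum_distrib_right mult.assoc sum.swap[of _ "{..<m}"])
  also have "\<dots> = 0" using s r by (auto simp: syzygy_def intro: sum.neutral)
  finally show "(\<Sum>j<m. F r j * (\<Sum>q<M. F' j q * v q)) = 0" .
qed

lemma keys_var [simp]: "keys (var i :: 'k::field mpol) = {Poly_Mapping.single i 1}"
  by (simp add: var_def xpow_def)

text \<open>
As all entries of the matrix have the same degree, the homogeneous components of a syzygy are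
syzygies.
\<close>

lemma syzygy_linear_part:
  assumes F: "homogeneous_entries V e R m F" and c: "syzygy V R m F c"
  shows "syzygy V R m F (\<lambda>j. component (\<lambda>l. tdeg l = 1) (c j))"
  unfolding syzygy_def
proof (intro conjI allI impI)
  fix j assume "j < m"
  then show "component (\<lambda>l. tdeg l = 1) (c j) \<in> supported (expos V)"
    using c by (auto simp: syzygy_def supported_def keys_component)
next
  fix r assume r: "r < R"
  have "(\<Sum>j<m. F r j * component (\<lambda>l. tdeg l = 1) (c j))
      = (\<Sum>j<m. component (\<lambda>l. tdeg l = e + 1) (F r j * c j))"
    using homogeneous_entriesD(2)[OF F r]
    by (intro sum.cong refl component_mult_homogeneous[symmetric]) (auto simp: tdeg_add)
  also have "\<dots> = component (\<lambda>l. tdeg l = e + 1) (\<Sum>j<m. F r j * c j)"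
    by (simp add: component_sum)
  also have "\<dots> = component (\<lambda>l. tdeg l = e + 1) 0" using c r by (simp add: syzygy_def)
  also have "\<dots> = 0" by (rule component_none) simp
  finally show "(\<Sum>j<m. F r j * component (\<lambda>l. tdeg l = 1) (c j)) = 0" .
qed

text \<open>
Assign each monomial of \<open>f\<close> to one generator dividing it.
\<close>

lemma monomial_combination:
  fixes f :: "'k::field mpol" and u :: "'i \<Rightarrow> expo"
  assumes X: "finite X" and f: "f \<in> supported {l\<in>expos V. \<exists>x\<in>X. cle (u x) l}"
  shows "\<exists>v. (\<forall>x. v x \<in> supported (expos V)) \<and> f = (\<Sum>x\<in>X. v x * xpow (u x))"
proof -
  have keys: "\<exists>x. x \<in> X \<and> cle (u x) l" "l \<in> expos V" if "l \<in> keys f" for l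
    using f that unfolding supported_def by blast+
  then have "\<forall>l\<in>keys f. \<exists>x. x \<in> X \<and> cle (u x) l" by blast
  from bchoice[OF this] obtain \<iota> where \<iota>: "\<And>l. l \<in> keys f \<Longrightarrow> \<iota> l \<in> X \<and> cle (u (\<iota> l)) l"
    by blast
  let ?K = "\<lambda>x. {l\<in>keys f. \<iota> l = x}"
  define v where "v x = (\<Sum>l\<in>?K x. Poly_Mapping.single (l - u x) (lookup f l))" for x
  have "v x * xpow (u x) = (\<Sum>l\<in>?K x. Poly_Mapping.single l (lookup f l))" for x
    unfolding v_def sum_distrib_right
  proof (rule sum.cong)
    fix l assume "l \<in> ?K x"
    then have "cle (u x) l" using \<iota> by blast
    then show "Poly_Mapping.single (l - u x) (lookup f l) * xpow (u x)
        = Poly_Mapping.single l (lookup f l)"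
      by (rule single_eq_single_mult_xpow[symmetric])
  qed simp
  then have "(\<Sum>x\<in>X. v x * xpow (u x)) = (\<Sum>x\<in>X. \<Sum>l\<in>?K x. Poly_Mapping.single l (lookup f l))"
    by simp
  also have "\<dots> = (\<Sum>l\<in>keys f. Poly_Mapping.single l (lookup f l))"
    using \<iota> by (intro sum.group) (auto simp: X)
  finally have "f = (\<Sum>x\<in>X. v x * xpow (u x))" by (simp flip: sum_monomials)
  moreover have "v x \<in> supported (expos V)" for x
    unfolding v_def by (intro supported_sum supported_single expos_diff) (use keys in auto)
  ultimately show ?thesis by (intro exI[of _ v]) simp
qed

lemma var_ideal_expand:
  assumes A: "A \<subseteq> V" "finite A" and f: "f \<in> (var_ideal V A :: 'k::field mpol set)"
  shows "\<exists>g. (\<forall>i. g i \<in> supported (expos V)) \<and> f = (\<Sum>i\<in>A. g i * var i)"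
proof -
  have "cle (Poly_Mapping.single i 1) l \<longleftrightarrow> 0 < lookup l i" for i l
    by (auto simp: cle_def lookup_single when_def Suc_le_eq)
  then have "f \<in> supported {l\<in>expos V. \<exists>i\<in>A. cle (Poly_Mapping.single i 1) l}"
    using f unfolding var_ideal_eq[OF A(1)] by simp
  from monomial_combination[OF A(2) this] show ?thesis by (simp add: var_def)
qed

lemma lex_enumeration:
  fixes A :: "nat \<Rightarrow> nat set"
  assumes "\<And>k. k < m \<Longrightarrow> finite (A k)"
  shows "\<exists>(M :: nat) \<kappa> \<iota>. (\<forall>q<M. \<kappa> q < m \<and> \<iota> q \<in> A (\<kappa> q)) \<and>
    (\<forall>k<m. \<forall>i\<in>A k. \<exists>q<M. \<kappa> q = k \<and> \<iota> q = i) \<and>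
    (\<forall>q q'. q < q' \<and> q' < M \<longrightarrow> \<kappa> q < \<kappa> q' \<or> \<kappa> q = \<kappa> q' \<and> \<iota> q < (\<iota> q' :: nat))"
proof -
  define L where "L = sorted_list_of_set (SIGMA k:{..<m}. A k)"
  have set: "set L = (SIGMA k:{..<m}. A k)" 
    unfolding L_def using assms by (intro set_sorted_list_of_set finite_SigmaI) auto
  have strict: "L ! q < L ! q'" if "q < q'" "q' < length L" for q q'
    by (rule sorted_wrt_nth_less[OF _ that]) (simp add: L_def)
  have mem: "L ! q \<in> (SIGMA k:{..<m}. A k)" if "q < length L" for q
    using nth_mem[OF that] set by simp
  show ?thesis
  proof (rule exI[of _ "length L"], rule exI[of _ "\<lambda>q. fst (L ! q)"],
      rule exI[of _ "\<lambda>q. snd (L ! q)"], intro conjI allI impI ballI)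
    fix q assume "q < length L"
    then show "fst (L ! q) < m" "snd (L ! q) \<in> A (fst (L ! q))" using mem[of q] by auto
  next
    fix k i assume "k < m" "i \<in> A k"
    then have "(k, i) \<in> set L" by (simp add: set)
    then show "\<exists>q<length L. fst (L ! q) = k \<and> snd (L ! q) = i"
      by (metis in_set_conv_nth fst_conv snd_conv)
  next
    fix q q' assume "q < q' \<and> q' < length L"
    then show "fst (L ! q) < fst (L ! q')
        \<or> fst (L ! q) = fst (L ! q') \<and> snd (L ! q) < snd (L ! q')"
      using strict[of q q'] by (simp add: less_prod_def')
  qed
qed

text \<open>
For \<open>i \<in> A\<^sub>k\<close> choose a syzygy \<open>s\<^sub>k\<^sub>i\<close> with linear entries and leading term \<open>x\<^sub>i e\<^sub>k\<close>, and let these be the columns of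
the new matrix, ordered lexicographically by \<open>(k, i)\<close>. They generate all syzygies, because the leading
coefficient of a syzygy at position \<open>k\<close> is a combination of the \<open>x\<^sub>i\<close> with \<open>i \<in> A\<^sub>k\<close>, so that its leading term
can be cancelled. Keeping track of positions in this reduction, a syzygy vanishing from position \<open>k\<close> on
is a combination of the \<open>s\<^sub>l\<^sub>j\<close> with \<open>l < k\<close>.

The new columns have linear quotients: for \<open>j < i\<close> in \<open>A\<^sub>k\<close> the vector \<open>x\<^sub>j s\<^sub>k\<^sub>i - x\<^sub>i s\<^sub>k\<^sub>j\<close> vanishes from
position \<open>k\<close> on, hence \<open>x\<^sub>j\<close> multiplies \<open>s\<^sub>k\<^sub>i\<close> into the span of the preceding columns. Conversely, the
coordinate at position \<open>k\<close> of a relation ending with \<open>g s\<^sub>k\<^sub>i\<close> shows that \<open>g x\<^sub>i\<close>, and therefore \<open>g\<close>, lies in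
the ideal generated by the \<open>x\<^sub>j\<close> with \<open>j \<in> A\<^sub>k\<close> and \<open>j < i\<close>.
\<close>

lemma linear_quotients_syzygies:
  fixes F :: "nat \<Rightarrow> nat \<Rightarrow> 'k::field mpol"
  assumes V: "finite V" and F: "homogeneous_entries V e R m F" and LQ: "linear_quotients V R m F"
  shows "\<exists>M F'. homogeneous_entries V 1 m M F' \<and> linear_quotients V m M F' \<and>
    (\<forall>c. syzygy V R m F c \<longleftrightarrow>
       (\<forall>j<m. c j \<in> supported (expos V)) \<and>
       (\<exists>v. (\<forall>q<M. v q \<in> supported (expos V)) \<and> (\<forall>j<m. c j = (\<Sum>q<M. F' j q * v q))))"
proof -
  obtain A where colon: "\<And>k. k < m \<Longrightarrow> colon_variables V R m F k (A k)"
    using LQ unfolding linear_quotients_def by metis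
  have A: "A k \<subseteq> V" if "k < m" for k
    using colon[OF that] by (simp add: colon_variables_def)
  have gen: "\<exists>c. syzygy V R m F c \<and> c k = var i \<and> (\<forall>j<m. k < j \<longrightarrow> c j = 0)"
    if "k < m" "i \<in> A k" for k i
    using colon[OF that(1)] that(2) by (simp add: colon_variables_def)
  have lead: "c k \<in> var_ideal V (A k)"
    if "k < m" "syzygy V R m F c" "\<forall>j<m. k < j \<longrightarrow> c j = 0" for k c
    using colon[OF that(1)] that(2,3) by (simp add: colon_variables_def)
  have finA: "finite (A k)" if "k < m" for k using A[OF that] V finite_subset by blast
  have "\<exists>c. syzygy V R m F c \<and> c k = var i \<and> (\<forall>j<m. k < j \<longrightarrow> c j = 0) \<and>
      (\<forall>j<m. \<forall>l\<in>keys (c j). tdeg l = 1)" if ki: "k < m" "i \<in> A k" for k i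
  proof -
    obtain c where c: "syzygy V R m F c" "c k = var i" "\<forall>j<m. k < j \<longrightarrow> c j = 0"
      using gen[OF ki] by blast
    let ?c = "\<lambda>j. component (\<lambda>l. tdeg l = 1) (c j)"
    have "syzygy V R m F ?c" by (rule syzygy_linear_part[OF F c(1)])
    moreover have "?c k = var i"
      unfolding c(2) by (rule component_all) (simp add: tdeg_single)
    moreover have "?c j = 0" if "j < m" "k < j" for j
      by (rule component_none) (use c(3) that in simp)
    moreover have "\<forall>l\<in>keys (?c j). tdeg l = 1" for j by (simp add: keys_component)
    ultimately show ?thesis by blast
  qed
  then obtain s where s: "\<And>k i. k < m \<Longrightarrow> i \<in> A k \<Longrightarrow>
      syzygy V R m F (s k i) \<and> s k i k = var i \<and> (\<forall>j<m. k < j \<longrightarrow> s k i j = 0) \<and>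
      (\<forall>j<m. \<forall>l\<in>keys (s k i j). tdeg l = 1)"
    by metis
  obtain M :: nat and \<kappa> \<iota> where enum: "\<forall>q<M. \<kappa> q < m \<and> \<iota> q \<in> A (\<kappa> q)"
      "\<forall>k<m. \<forall>i\<in>A k. \<exists>q<M. \<kappa> q = k \<and> \<iota> q = i"
      "\<forall>q q'. q < q' \<and> q' < M \<longrightarrow> \<kappa> q < \<kappa> q' \<or> \<kappa> q = \<kappa> q' \<and> \<iota> q < \<iota> q'"
    using lex_enumeration[of m A] finA by auto
  have \<kappa>: "\<kappa> q < m" and \<iota>: "\<iota> q \<in> A (\<kappa> q)" if "q < M" for q
    using enum(1) that by auto
  have index: "\<exists>q<M. \<kappa> q = k \<and> \<iota> q = i" if "k < m" "i \<in> A k" for k i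
    using enum(2) that by blast
  have lex: "\<kappa> q < \<kappa> q' \<or> \<kappa> q = \<kappa> q' \<and> \<iota> q < \<iota> q'" if "q < q'" "q' < M" for q q'
    using enum(3) that by blast
  define F' where "F' j q = s (\<kappa> q) (\<iota> q) j" for j q
  have syz: "syzygy V R m F (\<lambda>j. F' j q)" if "q < M" for q
    unfolding F'_def using s \<kappa> \<iota> that by blast
  have lincomb: "syzygy V R m F (\<lambda>j. \<Sum>q<M. F' j q * v q)"
    if "\<And>q. q < M \<Longrightarrow> v q \<in> supported (expos V)" for v
    by (rule syzygy_lincomb[OF F]) (use syz that in auto)
  have F'_lead: "F' (\<kappa> q) q = var (\<iota> q)" if "q < M" for q
    unfolding F'_def using s \<kappa> \<iota> that by blast
  have F'_zero: "F' l q = 0" if "q < M" "l < m" "\<kappa> q < l" for q l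
    unfolding F'_def using s \<kappa> \<iota> that by blast
  have F'_hom: "homogeneous_entries V 1 m M F'"
    unfolding homogeneous_entries_def
  proof (intro allI impI)
    fix j q assume "j < m" "q < M"
    then have "F' j q \<in> supported (expos V)" "\<forall>l\<in>keys (F' j q). tdeg l = 1"
      using syz[of q] s[of "\<kappa> q" "\<iota> q"] \<kappa> \<iota> by (auto simp: syzygy_def F'_def)
    then show "F' j q \<in> supported {l\<in>expos V. tdeg l = 1}" by (auto simp: supported_def)
  qed
  \<comment> \<open>The new matrix is block triangular with respect to the leading positions of its columns.\<close>
  have above: "(\<Sum>q<M. F' l q * v q) = 0"
    if "l < m" "k < l" "\<And>q. q < M \<Longrightarrow> k < \<kappa> q \<Longrightarrow> v q = 0" for k l v
  proof (rule sum.neutral, rule ballI)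
    fix q assume "q \<in> {..<M}"
    then show "F' l q * v q = 0"
      using that F'_zero[of q l] by (cases "k < \<kappa> q") auto
  qed
  have diagonal: "(\<Sum>q<M. F' k q * v q) = (\<Sum>q | q < M \<and> \<kappa> q = k. v q * var (\<iota> q))"
    if "k < m" "\<And>q. q < M \<Longrightarrow> k < \<kappa> q \<Longrightarrow> v q = 0" for k v
  proof (rule sum.mono_neutral_cong_right)
    show "\<forall>q\<in>{..<M} - {q. q < M \<and> \<kappa> q = k}. F' k q * v q = 0"
    proof
      fix q assume "q \<in> {..<M} - {q. q < M \<and> \<kappa> q = k}"
      then consider "q < M" "\<kappa> q < k" | "q < M" "k < \<kappa> q" by fastforce
      then show "F' k q * v q = 0" using that F'_zero[of q k] by cases auto
    qed
  qed (auto simp: F'_lead mult.commute)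
  have inj: "inj_on \<iota> {q. q < M \<and> \<kappa> q = k}" for k
  proof (rule inj_onI)
    fix q q' assume "q \<in> {q. q < M \<and> \<kappa> q = k}" "q' \<in> {q. q < M \<and> \<kappa> q = k}" "\<iota> q = \<iota> q'"
    then show "q = q'"
      using lex[of q q'] lex[of q' q] by (cases q q' rule: linorder_cases) auto
  qed
  have span: "\<exists>v. (\<forall>q<M. v q \<in> supported (expos V)) \<and> (\<forall>q<M. k \<le> \<kappa> q \<longrightarrow> v q = 0) \<and>
      (\<forall>j<m. c j = (\<Sum>q<M. F' j q * v q))"
    if "k \<le> m" "syzygy V R m F c" "\<forall>j<m. k \<le> j \<longrightarrow> c j = 0" for k c
    using that
  proof (induction k arbitrary: c)
    case 0
    then show ?case by (intro exI[of _ "\<lambda>_. 0"]) auto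
  next
    case (Suc k)
    then have k: "k < m" by simp
    have "c k \<in> var_ideal V (A k)"
      using lead[OF k Suc.prems(2)] Suc.prems(3) by (simp add: Suc_le_eq)
    then obtain g where g: "\<And>i. g i \<in> supported (expos V)" "c k = (\<Sum>i\<in>A k. g i * var i)"
      using var_ideal_expand[OF A[OF k] finA[OF k]] by blast
    define v where "v q = (if \<kappa> q = k then g (\<iota> q) else 0)" for q
    have v: "v q \<in> supported (expos V)" for q by (simp add: v_def g(1))
    have v_above: "v q = 0" if "k < \<kappa> q" for q using that by (simp add: v_def)
    let ?c = "\<lambda>j. c j - (\<Sum>q<M. F' j q * v q)"
    have "syzygy V R m F ?c"
      by (rule syzygy_diff[OF Suc.prems(2)], rule lincomb, rule v)
    moreover have "\<forall>j<m. k \<le> j \<longrightarrow> ?c j = 0"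
    proof (intro allI impI)
      fix j assume j: "j < m" "k \<le> j"
      show "?c j = 0"
      proof (cases "j = k")
        case True
        have "\<iota> ` {q. q < M \<and> \<kappa> q = k} = A k" using index[OF k] \<iota> by blast
        then have "c k = (\<Sum>q | q < M \<and> \<kappa> q = k. g (\<iota> q) * var (\<iota> q))"
          unfolding g(2) using sum.reindex[OF inj[of k], of "\<lambda>i. g i * var i"] by simp
        also have "\<dots> = (\<Sum>q<M. F' k q * v q)"
          by (subst diagonal[OF k v_above]) (auto simp: v_def intro: sum.cong)
        finally show ?thesis using True by simp
      next
        case False
        then have "k < j" using j by simp
        then show ?thesis using above[OF j(1) \<open>k < j\<close> v_above] Suc.prems(3) j by simp
      qed
    qed
    ultimately obtain v' where v': "\<And>q. q < M \<Longrightarrow> v' q \<in> supported (expos V)"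
        "\<And>q. q < M \<Longrightarrow> k \<le> \<kappa> q \<Longrightarrow> v' q = 0" "\<And>j. j < m \<Longrightarrow> ?c j = (\<Sum>q<M. F' j q * v' q)"
      using Suc.IH[of ?c] k by auto
    show ?case
    proof (intro exI[of _ "\<lambda>q. v q + v' q"] conjI allI impI)
      fix q assume q: "q < M"
      show "v q + v' q \<in> supported (expos V)" using v v'(1)[OF q] by (rule supported_add)
      show "v q + v' q = 0" if "Suc k \<le> \<kappa> q" using that v_above v'(2)[OF q] by simp
    next
      fix j assume "j < m"
      then show "c j = (\<Sum>q<M. F' j q * (v q + v' q))"
        using v'(3)[of j] by (simp add: distrib_left sum.distrib algebra_simps)
    qed
  qed
  have "linear_quotients V m M F'"
    unfolding linear_quotients_def
  proof (intro allI impI)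
    fix p assume p: "p < M"
    let ?k = "\<kappa> p" and ?A = "{i\<in>A (\<kappa> p). i < \<iota> p}"
    have after: "?k \<le> \<kappa> q" if "p < q" "q < M" for q using lex[OF that] by auto
    show "\<exists>A'. colon_variables V m M F' p A'"
      unfolding colon_variables_def
    proof (intro exI[of _ ?A] conjI ballI allI impI)
      show "?A \<subseteq> V" using A[OF \<kappa>[OF p]] by blast
    next
      fix i assume i: "i \<in> ?A"
      obtain q where q: "q < M" "\<kappa> q = ?k" "\<iota> q = i" using index[OF \<kappa>[OF p]] i by blast
      have qp: "q < p"
        using lex[of p q] q i by (cases q p rule: linorder_cases) auto
      \<comment> \<open>The combination of the columns p and q whose leading terms cancel.\<close>
      define w where "w r = (if r = p then var i else if r = q then - var (\<iota> p) else 0 :: 'k mpol)"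
        for r
      have iV: "i \<in> V" "\<iota> p \<in> V" using A[OF \<kappa>[OF p]] i \<iota>[OF p] by auto
      have w: "w r \<in> supported (expos V)" for r
        using iV by (auto simp: w_def intro: supported_uminus var_in_supported)
      let ?c = "\<lambda>j. \<Sum>r<M. F' j r * w r"
      have c_eq: "?c j = F' j p * var i - F' j q * var (\<iota> p)" for j
      proof -
        have "?c j = (\<Sum>r\<in>{p, q}. F' j r * w r)"
          by (rule sum.mono_neutral_right) (use p q(1) in \<open>auto simp: w_def\<close>)
        then show ?thesis using qp by (simp add: w_def)
      qed
      have "syzygy V R m F ?c" by (rule lincomb, rule w)
      moreover have "\<forall>j<m. ?k \<le> j \<longrightarrow> ?c j = 0"
        unfolding c_eq
        using F'_lead[OF p] F'_lead[OF q(1)] F'_zero[OF p] F'_zero[OF q(1)] q(2,3)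
        by (auto simp: le_less mult.commute)
      ultimately obtain v where v: "\<And>r. r < M \<Longrightarrow> v r \<in> supported (expos V)"
          "\<And>r. r < M \<Longrightarrow> ?k \<le> \<kappa> r \<Longrightarrow> v r = 0" "\<And>j. j < m \<Longrightarrow> ?c j = (\<Sum>r<M. F' j r * v r)"
        using span[of ?k ?c] \<kappa>[OF p] by auto
      show "\<exists>c. syzygy V m M F' c \<and> c p = var i \<and> (\<forall>q<M. p < q \<longrightarrow> c q = 0)"
      proof (intro exI[of _ "\<lambda>r. w r - v r"] conjI allI impI)
        show "syzygy V m M F' (\<lambda>r. w r - v r)"
          using v(1,3) w by (auto simp: syzygy_def right_diff_distrib sum_subtractf
              intro: supported_diff)
        show "w p - v p = var i" using v(2)[OF p] by (simp add: w_def)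
        fix r assume "r < M" "p < r"
        then show "w r - v r = 0" using v(2)[of r] after[of r] qp by (simp add: w_def)
      qed
    next
      fix c assume "syzygy V m M F' c" "\<forall>q<M. p < q \<longrightarrow> c q = 0"
      then have c: "\<And>q. q < M \<Longrightarrow> c q \<in> supported (expos V)"
          "\<And>j. j < m \<Longrightarrow> (\<Sum>q<M. F' j q * c q) = 0" "\<And>q. q < M \<Longrightarrow> p < q \<Longrightarrow> c q = 0"
        by (auto simp: syzygy_def)
      have c_above: "c q = 0" if "q < M" "?k < \<kappa> q" for q
        using that lex[of q p] p c(3)[of q] by (cases q p rule: linorder_cases) auto
      let ?Q = "{q. q < M \<and> \<kappa> q = ?k} - {p}"
      \<comment> \<open>The coordinate of the relation at the leading position of column p.\<close>
      have "0 = (\<Sum>q | q < M \<and> \<kappa> q = ?k. c q * var (\<iota> q))"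
        using diagonal[OF \<kappa>[OF p] c_above] c(2)[OF \<kappa>[OF p]] by simp
      also have "\<dots> = c p * var (\<iota> p) + (\<Sum>q\<in>?Q. c q * var (\<iota> q))"
        by (rule sum.remove) (use p in auto)
      finally have eq: "c p * var (\<iota> p) = - (\<Sum>q\<in>?Q. c q * var (\<iota> q))"
        by (simp add: eq_neg_iff_add_eq_0)
      have "\<exists>i\<in>?A. 0 < lookup l i" if l: "l \<in> keys (c p)" for l
      proof -
        let ?l = "l + Poly_Mapping.single (\<iota> p) 1"
        have "?l \<in> keys (c p * var (\<iota> p))" using l by (simp add: keys_mult_var)
        then have "?l \<in> keys (\<Sum>q\<in>?Q. c q * var (\<iota> q))"
          unfolding eq by (simp add: in_keys_iff)
        then obtain q where q: "q < M" "\<kappa> q = ?k" "q \<noteq> p" "?l \<in> keys (c q * var (\<iota> q))"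
          using keys_sum[of "\<lambda>q. c q * var (\<iota> q)" ?Q] by blast
        have "c q \<noteq> 0" using q(4) by auto
        then have "q < p" using c(3)[OF q(1)] q(3) by (cases q p rule: linorder_cases) auto
        then have less: "\<iota> q < \<iota> p" using lex[of q p] p q(2) by simp
        obtain l' where "?l = l' + Poly_Mapping.single (\<iota> q) 1"
          using q(4) by (auto simp: keys_mult_var)
        then have "lookup ?l (\<iota> q) = lookup l' (\<iota> q) + 1" by (simp add: lookup_add)
        then have "0 < lookup l (\<iota> q)" using less by (simp add: lookup_add lookup_single when_def)
        then show ?thesis using less \<iota>[OF q(1)] q(2) by auto
      qed
      moreover have "?A \<subseteq> V" using A[OF \<kappa>[OF p]] by blast
      ultimately show "c p \<in> var_ideal V ?A"
        using c(1)[OF p] by (auto simp: var_ideal_eq supported_def)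
    qed
  qed
  moreover have "syzygy V R m F c \<longleftrightarrow> (\<forall>j<m. c j \<in> supported (expos V)) \<and>
      (\<exists>v. (\<forall>q<M. v q \<in> supported (expos V)) \<and> (\<forall>j<m. c j = (\<Sum>q<M. F' j q * v q)))" for c
  proof
    assume c: "syzygy V R m F c"
    then show "(\<forall>j<m. c j \<in> supported (expos V)) \<and>
      (\<exists>v. (\<forall>q<M. v q \<in> supported (expos V)) \<and> (\<forall>j<m. c j = (\<Sum>q<M. F' j q * v q)))"
      using span[OF order_refl c] by (auto simp: syzygy_def)
  next
    assume "(\<forall>j<m. c j \<in> supported (expos V)) \<and>
      (\<exists>v. (\<forall>q<M. v q \<in> supported (expos V)) \<and> (\<forall>j<m. c j = (\<Sum>q<M. F' j q * v q)))"
    then obtain v where v: "\<And>q. q < M \<Longrightarrow> v q \<in> supported (expos V)"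
      and c: "\<And>j. j < m \<Longrightarrow> c j = (\<Sum>q<M. F' j q * v q)" by blast
    show "syzygy V R m F c"
      using lincomb[of v] v c by (simp add: syzygy_def)
  qed
  ultimately show ?thesis using F'_hom by blast
qed

section \<open>Linear resolutions and regularity\<close>

text \<open>
The bases are listed in increasing lexicographic order. If \<open>us ! l\<close> precedes \<open>us ! k\<close> and \<open>j\<close> is the first index where
they differ, then \<open>us ! k\<close> is larger there, and an exchange of \<open>j\<close> for a suitable \<open>i\<close> with
\<open>us ! k\<close> smaller at \<open>i\<close> yields a base that is lexicographically smaller than \<open>us ! k\<close>. Hence
\<open>x\<^sub>i\<close> multiplies the \<open>k\<close>-th generator into the ideal of the preceding ones, and \<open>x\<^sub>i\<close> divides every
monomial multiplying the \<open>k\<close>-th generator into the multiples of the \<open>l\<close>-th.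
\<close>

lemma (in exchange_family) linear_quotients_bases:
  defines "us \<equiv> sorted_list_of_set B"
  shows "linear_quotients V 1 (length us) (\<lambda>_ j. xpow (us ! j) :: 'k::field mpol)"
  unfolding linear_quotients_def
proof (intro allI impI)
  have set_us: "set us = B" by (simp add: us_def finite_family)
  have mem: "us ! j \<in> B" if "j < length us" for j using nth_mem[OF that] set_us by simp
  have mono: "us ! j \<le> us ! l" if "j \<le> l" "l < length us" for j l
    using sorted_nth_mono[of us] that by (simp add: us_def)
  have strict: "us ! j < us ! l" if "j < l" "l < length us" for j l
    by (rule sorted_wrt_nth_less[OF _ that]) (simp add: us_def)
  fix k assume k: "k < length us"
  define A where
    "A = {i\<in>V. \<exists>l<k. cle (us ! l) (us ! k + Poly_Mapping.single i 1)}"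
  show "\<exists>A. colon_variables V 1 (length us) (\<lambda>_ j. xpow (us ! j) :: 'k mpol) k A"
    unfolding colon_variables_def
  proof (intro exI[of _ A] conjI ballI allI impI)
    show AV: "A \<subseteq> V" by (auto simp: A_def)
    fix i assume "i \<in> A"
    then obtain l where i: "i \<in> V" and l: "l < k"
        "cle (us ! l) (us ! k + Poly_Mapping.single i 1)"
      by (auto simp: A_def)
    let ?x = "xpow (us ! k + Poly_Mapping.single i 1 - us ! l) :: 'k mpol"
    define c where "c j = (if j = k then var i else if j = l then - ?x else 0)" for j
    have "us ! k \<in> expos V" using mem[OF k] in_ground by (simp add: expos_def)
    then have x: "?x \<in> supported (expos V)"
      using i unfolding xpow_in_supported_iff by (intro expos_diff expos_add expos_single)
    have "(\<Sum>j<length us. xpow (us ! j) * c j) = (\<Sum>j\<in>{k, l}. xpow (us ! j) * c j)"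
      by (rule sum.mono_neutral_right) (use k l in \<open>auto simp: c_def\<close>)
    also have "\<dots> = 0"
      using l(1) cle_add_diff[OF l(2)] by (simp add: c_def var_def xpow_mult add.commute)
    finally show "\<exists>c. syzygy V 1 (length us) (\<lambda>_ j. xpow (us ! j) :: 'k mpol) c \<and> c k = var i \<and>
        (\<forall>j<length us. k < j \<longrightarrow> c j = 0)"
      using x i l(1) by (intro exI[of _ c])
        (auto simp: syzygy_def c_def var_in_supported supported_uminus)
  next
    fix c :: "nat \<Rightarrow> 'k mpol"
    assume syz: "syzygy V 1 (length us) (\<lambda>_ j. xpow (us ! j)) c"
      and after: "\<forall>j<length us. k < j \<longrightarrow> c j = 0"
    let ?J = "{..<length us} - {k}"
    have "0 = (\<Sum>j<length us. xpow (us ! j) * c j)" using syz by (simp add: syzygy_def)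
    also have "\<dots> = xpow (us ! k) * c k + (\<Sum>j\<in>?J. xpow (us ! j) * c j)"
      by (rule sum.remove) (use k in auto)
    finally have eq: "c k * xpow (us ! k) = - (\<Sum>j\<in>?J. c j * xpow (us ! j))"
      by (simp add: eq_neg_iff_add_eq_0 mult.commute)
    have "\<exists>i\<in>A. 0 < lookup m i" if m: "m \<in> keys (c k)" for m
    proof -
      have "m + us ! k \<in> keys (c k * xpow (us ! k))" using m by (simp add: keys_mult_xpow)
      then have "m + us ! k \<in> keys (\<Sum>j\<in>?J. c j * xpow (us ! j))"
        unfolding eq by (simp add: in_keys_iff)
      then obtain l where l: "l < length us" "l \<noteq> k" "m + us ! k \<in> keys (c l * xpow (us ! l))"
        using keys_sum[of "\<lambda>j. c j * xpow (us ! j)" ?J] by blast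
      have "c l \<noteq> 0" using l(3) by auto
      then have lk: "l < k" using after l(1,2) by (cases l k rule: linorder_cases) auto
      obtain m' where m': "m + us ! k = m' + us ! l" using l(3) by (auto simp: keys_mult_xpow)
      have "less_fun (lookup (us ! l)) (lookup (us ! k))"
        using strict[OF lk k] by (simp add: less_poly_mapping.rep_eq)
      then obtain j where j: "lookup (us ! l) j < lookup (us ! k) j"
          "\<And>i. i < j \<Longrightarrow> lookup (us ! l) i = lookup (us ! k) i"
        unfolding less_fun_def by blast
      obtain i where i: "lookup (us ! k) i < lookup (us ! l) i" "move j i (us ! k) \<in> B"
        using exchange[OF mem[OF k] mem[OF l(1)] j(1)] by blast
      have ji: "j < i" using i(1) j by (cases i j rule: linorder_cases) auto
      have less: "move j i (us ! k) < us ! k"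
        unfolding less_poly_mapping.rep_eq less_fun_def
        by (rule exI[of _ j]) (use ji j(1) in \<open>auto simp: lookup_move\<close>)
      obtain l' where l': "l' < length us" "us ! l' = move j i (us ! k)"
        using i(2) set_us by (metis in_set_conv_nth)
      have "l' < k"
        using less l' mono[of k l'] by (metis not_le)
      moreover have "cle (us ! l') (us ! k + Poly_Mapping.single i 1)"
        unfolding l'(2) by (auto simp: cle_def lookup_move lookup_add lookup_single when_def)
      moreover have "i \<in> V" using i(1) outside_ground[OF mem[OF l(1)]] by fastforce
      ultimately have "i \<in> A" unfolding A_def by blast
      moreover have "lookup m i + lookup (us ! k) i = lookup m' i + lookup (us ! l) i"
        using arg_cong[OF m', of "\<lambda>m. lookup m i"] by (simp add: lookup_add)
      ultimately show ?thesis using i(1) by (intro bexI[of _ i]) auto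
    qed
    moreover have "A \<subseteq> V" by (auto simp: A_def)
    ultimately show "c k \<in> var_ideal V A"
      using syz k by (auto simp: var_ideal_eq syzygy_def supported_def)
  qed
qed

lemma free_vecs_iff:
  "v \<in> free_vecs V m \<longleftrightarrow> v \<in> carrier_vec m \<and> (\<forall>j<m. v $ j \<in> supported (expos V))"
  by (simp add: free_vecs_def carrier_mpoly_ring)

lemma mat_mult_vec_nth:
  assumes "v \<in> carrier_vec m" "r < R"
  shows "(mat R m (\<lambda>(r, j). F r j) *\<^sub>v v) $ r = (\<Sum>j<m. F r j * v $ j)"
  using assms by (auto simp: scalar_prod_def atLeast0LessThan intro: sum.cong)

text \<open>
Minimality is automatic, as the entries of all differentials are linear forms and thus lie in the ideal
generated by the variables.
\<close>

lemma minimal_graded_free_resolution_of_sequence: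
  fixes F :: "nat \<Rightarrow> nat \<Rightarrow> nat \<Rightarrow> 'k::field mpol"
  assumes V: "finite V"
    and R: "R 0 = 1" "\<And>i. R (Suc i) = m i"
    and hom: "homogeneous_entries V d (R 0) (m 0) (F 0)"
      "\<And>i. homogeneous_entries V 1 (R (Suc i)) (m (Suc i)) (F (Suc i))"
    and J: "\<And>f. f \<in> J \<longleftrightarrow>
        (\<exists>v. (\<forall>j<m 0. v j \<in> supported (expos V)) \<and> f = (\<Sum>j<m 0. F 0 0 j * v j))"
    and exact: "\<And>i c. syzygy V (R i) (m i) (F i) c \<longleftrightarrow> (\<forall>j<m i. c j \<in> supported (expos V)) \<and>
        (\<exists>v. (\<forall>q<m (Suc i). v q \<in> supported (expos V)) \<and>
             (\<forall>j<m i. c j = (\<Sum>q<m (Suc i). F (Suc i) j q * v q)))"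
  shows "minimal_graded_free_resolution V J (\<lambda>i j. d + i)
           (\<lambda>i. mat (R i) (m i) (\<lambda>(r, j). F i r j))"
proof -
  let ?D = "\<lambda>i. mat (R i) (m i) (\<lambda>(r, j). F i r j)"
  have hom': "homogeneous_entries V (if i = 0 then d else 1) (R i) (m i) (F i)" for i
    using hom by (cases i) auto
  have entries: "elements_mat (?D i) \<subseteq> carrier (mpoly_ring V)" for i
    using homogeneous_entriesD(1)[OF hom'[of i]] by (auto simp: carrier_mpoly_ring)
  have "(\<lambda>v. (?D 0 *\<^sub>v v) $ 0) ` free_vecs V (m 0) = J"
  proof (intro equalityI subsetI)
    fix f assume "f \<in> (\<lambda>v. (?D 0 *\<^sub>v v) $ 0) ` free_vecs V (m 0)"
    then obtain v where v: "v \<in> free_vecs V (m 0)" "f = (?D 0 *\<^sub>v v) $ 0" by blast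
    then have "f = (\<Sum>j<m 0. F 0 0 j * v $ j)"
      using R(1) mat_mult_vec_nth[of v "m 0" 0 "R 0" "F 0"]
      by (simp add: free_vecs_iff del: index_mult_mat_vec)
    then show "f \<in> J"
      unfolding J using v(1) by (intro exI[of _ "\<lambda>j. v $ j"]) (simp add: free_vecs_iff)
  next
    fix f assume "f \<in> J"
    then obtain v where v: "\<forall>j<m 0. v j \<in> supported (expos V)" "f = (\<Sum>j<m 0. F 0 0 j * v j)"
      unfolding J by blast
    show "f \<in> (\<lambda>v. (?D 0 *\<^sub>v v) $ 0) ` free_vecs V (m 0)"
    proof (rule rev_image_eqI)
      show "vec (m 0) v \<in> free_vecs V (m 0)" using v(1) by (simp add: free_vecs_iff)
      show "f = (?D 0 *\<^sub>v vec (m 0) v) $ 0"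
        using R(1) v(2) mat_mult_vec_nth[of "vec (m 0) v" "m 0" 0 "R 0" "F 0"]
        by (simp del: index_mult_mat_vec)
    qed
  qed
  moreover have "(\<lambda>v. ?D (Suc i) *\<^sub>v v) ` free_vecs V (m (Suc i))
      = {v\<in>free_vecs V (m i). ?D i *\<^sub>v v = 0\<^sub>v (R i)}" for i
  proof -
    have kernel: "?D i *\<^sub>v c = 0\<^sub>v (R i) \<longleftrightarrow> (\<forall>r<R i. (\<Sum>j<m i. F i r j * c $ j) = 0)"
      if "c \<in> carrier_vec (m i)" for c
    proof -
      have "?D i *\<^sub>v c = 0\<^sub>v (R i) \<longleftrightarrow> (\<forall>r<R i. (?D i *\<^sub>v c) $ r = 0)"
        by (subst vec_eq_iff) simp
      then show ?thesis using mat_mult_vec_nth[OF that, of _ "R i" "F i"] by simp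
    qed
    have mem: "c \<in> {v\<in>free_vecs V (m i). ?D i *\<^sub>v v = 0\<^sub>v (R i)}
        \<longleftrightarrow> c \<in> carrier_vec (m i) \<and> syzygy V (R i) (m i) (F i) (\<lambda>j. c $ j)" for c
      using kernel[of c] by (auto simp: free_vecs_iff syzygy_def)
    show ?thesis
    proof (intro equalityI subsetI)
      fix c assume "c \<in> (\<lambda>v. ?D (Suc i) *\<^sub>v v) ` free_vecs V (m (Suc i))"
      then obtain v where v: "v \<in> free_vecs V (m (Suc i))" and c: "c = ?D (Suc i) *\<^sub>v v" by blast
      have cj: "c $ j = (\<Sum>q<m (Suc i). F (Suc i) j q * v $ q)" if "j < m i" for j
        unfolding c using v that by (intro mat_mult_vec_nth) (auto simp: free_vecs_iff R(2))
      have "c $ j \<in> supported (expos V)" if "j < m i" for j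
        unfolding cj[OF that] using v that homogeneous_entriesD(1)[OF hom(2)[of i]]
        by (intro supported_sum supported_expos_mult) (auto simp: free_vecs_iff R(2))
      then have "syzygy V (R i) (m i) (F i) (\<lambda>j. c $ j)"
        unfolding exact using v cj by (auto simp: free_vecs_iff intro!: exI[of _ "\<lambda>q. v $ q"])
      moreover have "c \<in> carrier_vec (m i)"
        unfolding c by (rule carrier_vecI) (simp add: R(2))
      ultimately show "c \<in> {v\<in>free_vecs V (m i). ?D i *\<^sub>v v = 0\<^sub>v (R i)}"
        by (simp only: mem simp_thms)
    next
      fix c assume "c \<in> {v\<in>free_vecs V (m i). ?D i *\<^sub>v v = 0\<^sub>v (R i)}"
      then obtain v where c: "c \<in> carrier_vec (m i)"
        and v: "\<forall>q<m (Suc i). v q \<in> supported (expos V)"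
          "\<forall>j<m i. c $ j = (\<Sum>q<m (Suc i). F (Suc i) j q * v q)"
        unfolding mem exact by blast
      show "c \<in> (\<lambda>v. ?D (Suc i) *\<^sub>v v) ` free_vecs V (m (Suc i))"
      proof (rule rev_image_eqI)
        show "vec (m (Suc i)) v \<in> free_vecs V (m (Suc i))" using v(1) by (simp add: free_vecs_iff)
        show "c = ?D (Suc i) *\<^sub>v vec (m (Suc i)) v"
        proof (rule eq_vecI)
          fix j assume "j < dim_vec (?D (Suc i) *\<^sub>v vec (m (Suc i)) v)"
          then have j: "j < R (Suc i)" by simp
          show "c $ j = (?D (Suc i) *\<^sub>v vec (m (Suc i)) v) $ j"
            using v(2) j mat_mult_vec_nth[of "vec (m (Suc i)) v" "m (Suc i)" j "R (Suc i)"
                "F (Suc i)"] by (simp add: R(2) del: index_mult_mat_vec)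
        qed (use c in \<open>simp add: R(2)\<close>)
      qed
    qed
  qed
  moreover have "elements_mat (?D (Suc i)) \<subseteq> var_ideal V V" for i
  proof
    fix f assume "f \<in> elements_mat (?D (Suc i))"
    then obtain r j where rj: "r < R (Suc i)" "j < m (Suc i)" "f = F (Suc i) r j"
      by auto
    have "l \<in> expos V" "tdeg l = 1" if "l \<in> keys f" for l
      using homogeneous_entriesD[OF hom(2) rj(1,2)] rj(3) that by (auto simp: supported_def)
    moreover from this have "0 < adeg V l" if "l \<in> keys f" for l
      using that tdeg_eq_adeg[OF V, of l] by (auto simp: expos_def)
    ultimately show "f \<in> var_ideal V V"
      using V by (auto simp: var_ideal_eq_adeg supported_def)
  qed
  ultimately show ?thesis
    unfolding minimal_graded_free_resolution_def
    using entries R homogeneous_entriesD(2)[OF hom(1)] homogeneous_entriesD(2)[OF hom(2)]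
    by auto
qed

text \<open>
The differentials are obtained by dependent choice, each one as a matrix of syzygies of the preceding one.
\<close>

lemma linear_resolution_exists:
  fixes F :: "nat \<Rightarrow> nat \<Rightarrow> 'k::field mpol"
  assumes V: "finite V" and F: "homogeneous_entries V d 1 m F" "linear_quotients V 1 m F"
    and J: "\<And>f. f \<in> J \<longleftrightarrow>
        (\<exists>v. (\<forall>j<m. v j \<in> supported (expos V)) \<and> f = (\<Sum>j<m. F 0 j * v j))"
  shows "\<exists>D. minimal_graded_free_resolution V J (\<lambda>i j. d + i) D"
proof -
  define good where "good n x \<longleftrightarrow> (case x of (R, m', F') \<Rightarrow>
      linear_quotients V R m' F' \<and> homogeneous_entries V (if n = 0 then d else 1) R m' F' \<and>
      (n = 0 \<longrightarrow> x = (1, m, F)))" for n :: nat and x :: "nat \<times> nat \<times> (nat \<Rightarrow> nat \<Rightarrow> 'k mpol)"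
  define resolves where "resolves x y \<longleftrightarrow> (case x of (R, m, F) \<Rightarrow> case y of (R', m', F') \<Rightarrow> R' = m \<and>
      (\<forall>c. syzygy V R m F c \<longleftrightarrow> (\<forall>j<m. c j \<in> supported (expos V)) \<and>
        (\<exists>v. (\<forall>q<m'. v q \<in> supported (expos V)) \<and> (\<forall>j<m. c j = (\<Sum>q<m'. F' j q * v q)))))"
    for x y :: "nat \<times> nat \<times> (nat \<Rightarrow> nat \<Rightarrow> 'k mpol)"
  have "\<exists>y. good (Suc n) y \<and> resolves x y" if "good n x" for n x
  proof -
    obtain R m' F' where x: "x = (R, m', F')" by (cases x)
    have "linear_quotients V R m' F'" "homogeneous_entries V (if n = 0 then d else 1) R m' F'"
      using that by (auto simp: good_def x)
    from linear_quotients_syzygies[OF V this(2,1)] obtain M F'' where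
      "homogeneous_entries V 1 m' M F''" "linear_quotients V m' M F''"
      "\<forall>c. syzygy V R m' F' c \<longleftrightarrow> (\<forall>j<m'. c j \<in> supported (expos V)) \<and>
        (\<exists>v. (\<forall>q<M. v q \<in> supported (expos V)) \<and> (\<forall>j<m'. c j = (\<Sum>q<M. F'' j q * v q)))"
      by blast
    then show ?thesis
      by (intro exI[of _ "(m', M, F'')"]) (simp add: good_def resolves_def x)
  qed
  moreover have "good 0 (1, m, F)" using F by (simp add: good_def)
  ultimately obtain X where X: "\<And>n. good n (X n)" "\<And>n. resolves (X n) (X (Suc n))"
    using dependent_nat_choice[of good "\<lambda>_. resolves"] by metis
  have X0: "X 0 = (1, m, F)" using X(1)[of 0] by (auto simp: good_def)
  have "minimal_graded_free_resolution V J (\<lambda>i j. d + i)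
      (\<lambda>i. mat (fst (X i)) (fst (snd (X i))) (\<lambda>(r, j). snd (snd (X i)) r j))"
  proof (rule minimal_graded_free_resolution_of_sequence[OF V])
    show "fst (X (Suc i)) = fst (snd (X i))" for i
      using X(2)[of i] by (simp add: resolves_def split: prod.splits)
    show "homogeneous_entries V 1 (fst (X (Suc i))) (fst (snd (X (Suc i)))) (snd (snd (X (Suc i))))"
      for i using X(1)[of "Suc i"] by (simp add: good_def split: prod.splits)
    show "syzygy V (fst (X i)) (fst (snd (X i))) (snd (snd (X i))) c \<longleftrightarrow>
        (\<forall>j<fst (snd (X i)). c j \<in> supported (expos V)) \<and>
        (\<exists>v. (\<forall>q<fst (snd (X (Suc i))). v q \<in> supported (expos V)) \<and>
          (\<forall>j<fst (snd (X i)). c j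
             = (\<Sum>q<fst (snd (X (Suc i))). snd (snd (X (Suc i))) j q * v q)))" for i c
      using X(2)[of i] by (simp add: resolves_def split: prod.splits)
  qed (use F J in \<open>simp_all add: X0\<close>)
  then show ?thesis by blast
qed

lemma supported_iff_combination:
  fixes us :: "nat \<Rightarrow> expo"
  assumes B: "\<And>j. j < m \<Longrightarrow> us j \<in> expos V"
  shows "f \<in> (supported {l\<in>expos V. \<exists>j<m. cle (us j) l} :: 'k::field mpol set) \<longleftrightarrow>
    (\<exists>v. (\<forall>j<m. v j \<in> supported (expos V)) \<and> f = (\<Sum>j<m. xpow (us j) * v j))"
proof
  assume "\<exists>v. (\<forall>j<m. v j \<in> supported (expos V)) \<and> f = (\<Sum>j<m. xpow (us j) * v j)"
  then obtain v where v: "\<And>j. j < m \<Longrightarrow> v j \<in> supported (expos V)"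
    and f: "f = (\<Sum>j<m. xpow (us j) * v j)" by blast
  show "f \<in> supported {l\<in>expos V. \<exists>j<m. cle (us j) l}"
    unfolding f
  proof (rule supported_sum)
    fix j assume j: "j \<in> {..<m}"
    then have "v j * xpow (us j) \<in> supported {l\<in>expos V. \<exists>j<m. cle (us j) l}"
      using v[of j] B[of j] cle_add[of "us j"]
      by (auto simp: supported_def keys_mult_xpow intro: expos_add)
    then show "xpow (us j) * v j \<in> supported {l\<in>expos V. \<exists>j<m. cle (us j) l}"
      by (simp add: mult.commute)
  qed
next
  assume "f \<in> supported {l\<in>expos V. \<exists>j<m. cle (us j) l}"
  then have "f \<in> supported {l\<in>expos V. \<exists>j\<in>{..<m}. cle (us j) l}" by (simp add: Bex_def)
  from monomial_combination[OF finite_lessThan this]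
  show "\<exists>v. (\<forall>j<m. v j \<in> supported (expos V)) \<and> f = (\<Sum>j<m. xpow (us j) * v j)"
    by (auto simp: mult.commute)
qed

text \<open>
The nonzero entries of the augmentation are elements of the ideal, and there is one since the ideal is not
zero.
\<close>

lemma resolution_shift_ge:
  fixes J :: "'k::field mpol set"
  assumes res: "minimal_graded_free_resolution V J a D"
    and J: "f \<in> J" "f \<noteq> 0" "\<And>g l. g \<in> J \<Longrightarrow> l \<in> keys g \<Longrightarrow> d \<le> tdeg l"
  shows "\<exists>j<dim_col (D 0). d \<le> a 0 j"
proof -
  have row: "dim_row (D 0) = 1"
    and deg: "\<forall>j<dim_col (D 0). \<forall>m\<in>keys (D 0 $$ (0, j)). tdeg m = a 0 j"
    and image: "(\<lambda>v. (D 0 *\<^sub>v v) $ 0) ` free_vecs V (dim_col (D 0)) = J"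
    using res by (simp_all add: minimal_graded_free_resolution_def del: index_mult_mat_vec)
  have nth: "(D 0 *\<^sub>v v) $ 0 = (\<Sum>j<dim_col (D 0). D 0 $$ (0, j) * v $ j)"
    if "v \<in> carrier_vec (dim_col (D 0))" for v
    using that row by (auto simp: scalar_prod_def atLeast0LessThan intro: sum.cong)
  obtain v where v: "v \<in> free_vecs V (dim_col (D 0))" "f = (D 0 *\<^sub>v v) $ 0"
    using J(1) image by blast
  have "\<exists>j<dim_col (D 0). D 0 $$ (0, j) \<noteq> 0"
  proof (rule ccontr)
    assume "\<not> ?thesis"
    then have "(D 0 *\<^sub>v v) $ 0 = 0"
      using v(1) nth[of v] by (auto simp: free_vecs_iff)
    then show False using J(2) v(2) by simp
  qed
  then obtain j where j: "j < dim_col (D 0)" "D 0 $$ (0, j) \<noteq> 0" by blast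
  let ?e = "unit_vec (dim_col (D 0)) j :: 'k mpol vec"
  have "?e \<in> free_vecs V (dim_col (D 0))"
    by (auto simp: free_vecs_iff unit_vec_def one_in_supported)
  then have "(D 0 *\<^sub>v ?e) $ 0 \<in> J" using image by blast
  also have "(D 0 *\<^sub>v ?e) $ 0 = D 0 $$ (0, j)"
    using j(1) by (subst nth) (auto simp: unit_vec_def if_distrib cong: if_cong)
  finally have "D 0 $$ (0, j) \<in> J" .
  moreover obtain l where "l \<in> keys (D 0 $$ (0, j))"
    using j(2) by (metis keys_eq_empty ex_in_conv)
  ultimately show ?thesis using deg J(3) j(1) by fastforce
qed

text \<open>
The linear resolution with shifts \<open>d + i\<close> shows that the regularity is at most \<open>d\<close>. It cannot be smaller, as no
minimal resolution can have all generators of the ideal in degrees below \<open>d\<close>.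
\<close>

theorem (in exchange_family) regularity_base_ideal:
  "regularity V (base_ideal :: 'k::field mpol set) = d"
proof -
  define us where "us = sorted_list_of_set B"
  have set_us: "set us = B" by (simp add: us_def finite_family)
  have mem: "us ! j \<in> B" if "j < length us" for j using nth_mem[OF that] set_us by simp
  have dom: "(\<exists>u\<in>B. cle u l) \<longleftrightarrow> (\<exists>j<length us. cle (us ! j) l)" for l
    unfolding set_us[symmetric] by (metis in_set_conv_nth)
  have "\<exists>D. minimal_graded_free_resolution V (base_ideal :: 'k mpol set) (\<lambda>i j. d + i) D"
  proof (rule linear_resolution_exists[OF finite_ground])
    show "homogeneous_entries V d 1 (length us) (\<lambda>_ j. xpow (us ! j) :: 'k mpol)"
      unfolding homogeneous_entries_def
      using mem in_ground equal_degree by (auto simp: xpow_in_supported_iff expos_def)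
    show "linear_quotients V 1 (length us) (\<lambda>_ j. xpow (us ! j) :: 'k mpol)"
      unfolding us_def by (rule linear_quotients_bases)
    show "f \<in> base_ideal \<longleftrightarrow> (\<exists>v. (\<forall>j<length us. v j \<in> supported (expos V)) \<and>
        f = (\<Sum>j<length us. xpow (us ! j) * v j))" for f :: "'k mpol"
      unfolding dom by (rule supported_iff_combination) (use mem in_ground in \<open>auto simp: expos_def\<close>)
  qed
  then obtain D where D: "minimal_graded_free_resolution V (base_ideal :: 'k mpol set) (\<lambda>i j. d + i) D"
    by blast
  show ?thesis
    unfolding regularity_def
  proof (rule Least_equality)
    show "\<exists>a D. minimal_graded_free_resolution V (base_ideal :: 'k mpol set) a D \<and>
        (\<forall>i. \<forall>j<dim_col (D i). a i j \<le> d + i)"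
      using D by (intro exI[of _ "\<lambda>i j. d + i"] exI[of _ D]) simp
  next
    fix r assume "\<exists>a D. minimal_graded_free_resolution V (base_ideal :: 'k mpol set) a D \<and>
        (\<forall>i. \<forall>j<dim_col (D i). a i j \<le> r + i)"
    then obtain a D where res: "minimal_graded_free_resolution V (base_ideal :: 'k mpol set) a D"
      and le: "\<And>i j. j < dim_col (D i) \<Longrightarrow> a i j \<le> r + i" by blast
    obtain u where u: "u \<in> B" using nonempty by blast
    have "xpow u \<in> (base_ideal :: 'k mpol set)"
      using u in_ground by (auto simp: xpow_in_supported_iff expos_def cle_def)
    moreover have "xpow u \<noteq> (0 :: 'k mpol)" by (simp add: xpow_def flip: keys_eq_empty)
    moreover have "d \<le> tdeg l" if gl: "g \<in> (base_ideal :: 'k mpol set)" "l \<in> keys g" for g l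
    proof -
      obtain u where "u \<in> B" "cle u l" using gl by (auto simp: supported_def)
      then have "tdeg (l - u) + d = tdeg l"
        using equal_degree cle_add_diff[of u l] by (metis tdeg_add)
      then show ?thesis by simp
    qed
    ultimately obtain j where "j < dim_col (D 0)" "d \<le> a 0 j"
      using resolution_shift_ge[OF res, of "xpow u" d] by blast
    then show "d \<le> r" using le[of j 0] by simp
  qed
qed

section \<open>Polymatroidal ideals\<close>

theorem proposition2p1:
  fixes n :: nat and I :: "((nat \<Rightarrow>\<^sub>0 nat) \<Rightarrow>\<^sub>0 'k::field) set"
  assumes "polymatroidal_ideal {1..n} I"
  shows "strong_intersection_type {1..n} I"
proof -
  let ?V = "{1..n}"
  obtain P where P: "discrete_polymatroid ?V P" and I: "I = Idl\<^bsub>mpoly_ring ?V\<^esub> (xpow ` bases P)"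
    using assms unfolding polymatroidal_ideal_def by blast
  interpret exchange_family ?V "bases P" "Max (tdeg ` P)"
    by (rule exchange_family_bases[OF _ P]) simp
  let ?d = "\<lambda>p. mindeg (bases P) (prime_vars ?V p)"
  have I_eq: "I = base_ideal"
    unfolding I by (rule genideal_xpow) (use in_ground in \<open>auto simp: expos_def\<close>)
  have irr: "irredundant_presentation ?V I ((\<lambda>p. (p, ?d p)) ` associated_primes (mpoly_ring ?V) I)"
    unfolding I_eq by (rule irredundant_presentation_base_ideal)
  have "monomial_ideal ?V I"
    unfolding monomial_ideal_def using I in_ground by blast
  moreover have "\<exists>F. presentation ?V I F"
    using irr unfolding irredundant_presentation_def by blast
  moreover have "?d p = regularity (prime_vars ?V p) (monomial_localization ?V I p)"
    if p_ass: "p \<in> associated_primes (mpoly_ring ?V) I" for p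
  proof -
    obtain A where A: "A \<subseteq> ?V" and p: "p = var_ideal ?V A"
      using associated_prime_base_ideal_eq[OF p_ass[unfolded I_eq]] by blast
    interpret loc: exchange_family A
      "restr A ` {u\<in>bases P. adeg A u = mindeg (bases P) A}" "mindeg (bases P) A"
      by (rule exchange_family_restr[OF A])
    have "regularity A (monomial_localization ?V I p) = mindeg (bases P) A"
      unfolding p I_eq monomial_localization_base_ideal[OF A] by (rule loc.regularity_base_ideal)
    then show ?thesis unfolding p prime_vars_var_ideal[OF A] by simp
  qed
  ultimately show ?thesis
    unfolding strong_intersection_type_def intersection_type_def
    using irr by (intro conjI exI[of _ ?d]) simp_all
qed

end
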